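(* There is an absolute constant $\varepsilon > 0$ such that the following holds. Let $C_0, c_1, C_1 > 0$. Then there is $c = c(C_0,c_1,C_1) > 0$ such that for every prime $q$, with $F := \mathbf{Z}/q\mathbf{Z}$: if $L$ is a collection of lines in $F^3$ with $c_1|F|^2 \leq |L| \leq C_1 |F|^2$ which obeys the Wolff axiom with constant $C_0$ (every 2-plane in $F^3$ contains at most $C_0|F|$ lines of $L$), and $P \subseteq F^3$ is a set of points containing every line of $L$, then $$|P| \geq c\,|F|^{5/2+\varepsilon}.$$
   Context: Lines in $F^3$ are sets $\{x + t v : t \in F\}$ with $x \in F^3$, $v \in F^3\setminus\{0\}$; 2-planes are sets $\{x + s v + t w : s,t\in F\}$ with $v,w$ linearly independent. A collection of lines obeys the Wolff axiom if every 2-plane contains $O(|F|)$ of its lines. (In particular, a Besicovitch set—a set of points in $F^3$ containing a line in every direction—has cardinality $\gtrsim |F|^{5/2+\varepsilon}$.) *)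

theory Defs
  imports Complex_Main "HOL-Algebra.Ring" "HOL-Number_Theory.Residues"
begin

type_synonym 'a triple = "'a \<times> 'a \<times> 'a"

definition space3 :: "('a, 'm) ring_scheme \<Rightarrow> 'a triple set" where
  "space3 F = carrier F \<times> carrier F \<times> carrier F"

definition zero3 :: "('a, 'm) ring_scheme \<Rightarrow> 'a triple" where
  "zero3 F = (\<zero>\<^bsub>F\<^esub>, \<zero>\<^bsub>F\<^esub>, \<zero>\<^bsub>F\<^esub>)"

fun add3 :: "('a, 'm) ring_scheme \<Rightarrow> 'a triple \<Rightarrow> 'a triple \<Rightarrow> 'a triple" where
  "add3 F (x1, x2, x3) (y1, y2, y3) = (x1 \<oplus>\<^bsub>F\<^esub> y1, x2 \<oplus>\<^bsub>F\<^esub> y2, x3 \<oplus>\<^bsub>F\<^esub> y3)"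

fun smult3 :: "('a, 'm) ring_scheme \<Rightarrow> 'a \<Rightarrow> 'a triple \<Rightarrow> 'a triple" where
  "smult3 F t (v1, v2, v3) = (t \<otimes>\<^bsub>F\<^esub> v1, t \<otimes>\<^bsub>F\<^esub> v2, t \<otimes>\<^bsub>F\<^esub> v3)"

definition lin_indep3 :: "('a, 'm) ring_scheme \<Rightarrow> 'a triple \<Rightarrow> 'a triple \<Rightarrow> bool" where
  "lin_indep3 F v w \<longleftrightarrow>
     (\<forall>a\<in>carrier F. \<forall>b\<in>carrier F.
        add3 F (smult3 F a v) (smult3 F b w) = zero3 F \<longrightarrow> a = \<zero>\<^bsub>F\<^esub> \<and> b = \<zero>\<^bsub>F\<^esub>)"

definition line_through :: "('a, 'm) ring_scheme \<Rightarrow> 'a triple \<Rightarrow> 'a triple \<Rightarrow> 'a triple set" where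
  "line_through F x v = {add3 F x (smult3 F t v) | t. t \<in> carrier F}"

definition plane_through ::
  "('a, 'm) ring_scheme \<Rightarrow> 'a triple \<Rightarrow> 'a triple \<Rightarrow> 'a triple \<Rightarrow> 'a triple set" where
  "plane_through F x v w =
     {add3 F (add3 F x (smult3 F s v)) (smult3 F t w) | s t. s \<in> carrier F \<and> t \<in> carrier F}"

definition lines3 :: "('a, 'm) ring_scheme \<Rightarrow> 'a triple set set" where
  "lines3 F = {line_through F x v | x v. x \<in> space3 F \<and> v \<in> space3 F - {zero3 F}}"

definition planes3 :: "('a, 'm) ring_scheme \<Rightarrow> 'a triple set set" where
  "planes3 F = {plane_through F x v w | x v w.
     x \<in> space3 F \<and> v \<in> space3 F \<and> w \<in> space3 F \<and> lin_indep3 F v w}"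

definition wolff_axiom :: "('a, 'm) ring_scheme \<Rightarrow> real \<Rightarrow> 'a triple set set \<Rightarrow> bool" where
  "wolff_axiom F C L \<longleftrightarrow>
     (\<forall>\<pi>\<in>planes3 F. real (card {l \<in> L. l \<subseteq> \<pi>}) \<le> C * real (card (carrier F)))"

end

(*
  Polynomial method.  If P is small, some nonzero f of degree d, a small multiple of q, vanishes on P,
  hence on every line of L.  Peel lines off L.  A line at least half of whose points lie on at most two
  remaining lines may be removed; each point is charged for this at most twice, so at most 4 |P| / q
  lines disappear in this way.  If there is no such line, let f have minimal degree among the
  polynomials vanishing on the remaining lines.  Since d < q = char F, the gradient of f does not
  vanish identically on some remaining line l.  At a point of l where l meets two further lines, the
  derivative of the gradient along l is parallel to the gradient (f is flat there).  There are more
  such points than the degree allows, so the tangent plane is constant along l.  That plane contains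
  all lines meeting l at regular points, so f vanishes on it; dividing f by its equation lowers the
  degree by one at the cost of the at most C0 q lines in the plane.
  Altogether |L| <= 4 |P| / q + C0 q d, which forces |P| >= c q^3, i.e. epsilon = 1/2.
*)
theory Submission
  imports Defs Berlekamp_Zassenhaus.Finite_Field
begin

hide_const (open) UnivPoly.coeff UnivPoly.monom

section \<open>Polynomial functions on three-dimensional space\<close>

text \<open>In coordinates where l is the x-axis, f = a(x) y + b(x) z + terms of higher order, and
  (a, b) is the gradient along l. Two further zero lines through a point of l force the Wronskian a
  b' - a' b to vanish there. Its degree is at most 2 d, so it vanishes identically, and (a, b) has a
  constant direction. This conclusion and the existence of a regular point both infer constancy from
  a zero derivative, which is where the degree must stay below the characteristic. The obstacle is
  real: over a field of p^2 elements the surface z - z^p = x y^p - x^p y has degree p + 1 and only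
  p^5 points, yet contains about p^4 lines, O(p) of them in any plane. Taking f of minimal degree
  for the current lines replaces factorization: a repeated factor would make the gradient vanish on
  all its lines. The condition 6 d < q leaves room for 2 d < q / 2 (Wronskian) and d < q / 2 - d
  (regular points). Interpolation on a box of side m has d = 3 (m - 1), which explains the 18
  below.\<close>

type_synonym 'a pt = "'a \<times> 'a \<times> 'a"

fun pt_at :: "'a::comm_ring_1 pt \<Rightarrow> 'a pt \<Rightarrow> 'a \<Rightarrow> 'a pt" where
  "pt_at (a, b, c) (u, v, w) t = (a + t * u, b + t * v, c + t * w)"

fun aff :: "'a::comm_ring_1 \<Rightarrow> 'a \<Rightarrow> 'a \<Rightarrow> 'a \<Rightarrow> 'a pt \<Rightarrow> 'a" where
  "aff c0 c1 c2 c3 (x, y, z) = c0 + c1 * x + c2 * y + c3 * z"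

text \<open>Polynomials of degree at most \<open>n\<close> are handled as functions: the degrees that occur are
  smaller than the order of the field, so that polynomial and function determine each other.\<close>

inductive poly3 :: "nat \<Rightarrow> ('a::comm_ring_1 pt \<Rightarrow> 'a) \<Rightarrow> bool" where
  poly3_const: "poly3 n (\<lambda>_. c)"
| poly3_add: "poly3 n f \<Longrightarrow> poly3 n g \<Longrightarrow> poly3 n (\<lambda>p. f p + g p)"
| poly3_aff_mult: "poly3 n f \<Longrightarrow> poly3 (Suc n) (\<lambda>p. aff c0 c1 c2 c3 p * f p)"

lemma poly3_Suc: "poly3 n f \<Longrightarrow> poly3 (Suc n) f"
  by (induction rule: poly3.induct) (auto intro: poly3.intros)

lemma poly3_mono: "poly3 m f \<Longrightarrow> m \<le> n \<Longrightarrow> poly3 n f"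
  by (induction n) (auto simp: le_Suc_eq intro: poly3_Suc)

lemma poly3_cmult: "poly3 n f \<Longrightarrow> poly3 n (\<lambda>p. c * f p)"
proof (induction rule: poly3.induct)
  case (poly3_add n f g)
  then show ?case using poly3.poly3_add[OF poly3_add.IH] by (simp add: algebra_simps)
next
  case (poly3_aff_mult n f c0 c1 c2 c3)
  then show ?case using poly3.poly3_aff_mult[OF poly3_aff_mult.IH, of c0 c1 c2 c3]
    by (simp add: algebra_simps)
qed (rule poly3.intros)

lemma poly3_0_const: "poly3 n f \<Longrightarrow> n = 0 \<Longrightarrow> \<exists>c. \<forall>p. f p = c"
  by (induction rule: poly3.induct) auto

text \<open>Truncated subtraction gives \<open>n - 1 = n\<close> at \<open>n = 0\<close>. The second
  hypothesis covers this case: quotients and derivatives of constants are zero, so the product does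
  not gain a degree.\<close>

lemma poly3_aff_mult_pred:
  assumes "poly3 (n - 1) h" "n = 0 \<longrightarrow> (\<forall>p. h p = 0)"
  shows "poly3 n (\<lambda>p. aff c0 c1 c2 c3 p * h p)"
proof (cases n)
  case 0
  with assms have "(\<lambda>p. aff c0 c1 c2 c3 p * h p) = (\<lambda>_. 0)" by auto
  then show ?thesis by (simp add: poly3_const)
qed (use assms in \<open>auto intro: poly3_aff_mult\<close>)

section \<open>Affine changes of coordinates and division by an affine function\<close>

definition affmap :: "('a::comm_ring_1 pt \<Rightarrow> 'a pt) \<Rightarrow> bool" where
  "affmap A \<longleftrightarrow> (\<exists>a0 a1 a2 a3 b0 b1 b2 b3 c0 c1 c2 c3.
     \<forall>p. A p = (aff a0 a1 a2 a3 p, aff b0 b1 b2 b3 p, aff c0 c1 c2 c3 p))"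

text \<open>With the scalar -1, \<open>pt_at\<close> is vector subtraction: A(v) - A(0).\<close>

definition linpart :: "('a::comm_ring_1 pt \<Rightarrow> 'a pt) \<Rightarrow> 'a pt \<Rightarrow> 'a pt" where
  "linpart A v = pt_at (A v) (A (0, 0, 0)) (- 1)"

lemma affmapI:
  assumes "\<And>x y z. A (x, y, z) = (a0 + a1 * x + a2 * y + a3 * z,
     b0 + b1 * x + b2 * y + b3 * z, c0 + c1 * x + c2 * y + c3 * z)"
  shows "affmap A"
proof -
  have "\<forall>p. A p = (aff a0 a1 a2 a3 p, aff b0 b1 b2 b3 p, aff c0 c1 c2 c3 p)"
    using assms by auto
  then show ?thesis unfolding affmap_def by blast
qed

lemma affmap_pt_at:
  assumes "affmap A"
  shows "A (pt_at p v t) = pt_at (A p) (linpart A v) t"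
proof -
  from assms obtain a0 a1 a2 a3 b0 b1 b2 b3 c0 c1 c2 c3 where
    A: "\<And>p. A p = (aff a0 a1 a2 a3 p, aff b0 b1 b2 b3 p, aff c0 c1 c2 c3 p)"
    unfolding affmap_def by blast
  show ?thesis by (cases p; cases v) (simp add: A linpart_def algebra_simps)
qed

lemma poly3_affmap:
  assumes "poly3 n f" "affmap A"
  shows "poly3 n (\<lambda>p. f (A p))"
proof -
  from assms(2) obtain a0 a1 a2 a3 b0 b1 b2 b3 c0 c1 c2 c3 where
    A: "\<And>p. A p = (aff a0 a1 a2 a3 p, aff b0 b1 b2 b3 p, aff c0 c1 c2 c3 p)"
    unfolding affmap_def by blast
  have aff: "aff k0 k1 k2 k3 (A p) = aff (k0 + k1*a0 + k2*b0 + k3*c0) (k1*a1 + k2*b1 + k3*c1)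
     (k1*a2 + k2*b2 + k3*c2) (k1*a3 + k2*b3 + k3*c3) p" for k0 k1 k2 k3 p
    by (cases p) (simp add: A algebra_simps)
  from assms(1) show ?thesis
    by (induction rule: poly3.induct) (auto simp only: aff intro: poly3.intros)
qed

text \<open>Division by \<open>l\<close> with the remainder written as \<open>f\<close> at a point
  shifted along \<open>u\<close>. If the linear part of \<open>l\<close> is 1 at \<open>u\<close>,
  the shifted point lies on the plane l = 0, so the remainder disappears whenever \<open>f\<close>
  vanishes on that plane. The formula itself holds for every \<open>u\<close>.\<close>

lemma poly3_div_aff:
  assumes "poly3 n f" and l: "\<And>p. l p = aff k0 k1 k2 k3 p"
  shows "\<exists>h. poly3 (n - 1) h \<and> (n = 0 \<longrightarrow> (\<forall>p. h p = 0)) \<and>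
     (\<forall>p. f p = f (pt_at p u (- l p)) + l p * h p)"
  using assms(1)
proof (induction rule: poly3.induct)
  case (poly3_const n c)
  show ?case by (rule exI[of _ "\<lambda>_. 0"]) (simp add: poly3.poly3_const)
next
  case (poly3_add n f g)
  then obtain h h' where "poly3 (n - 1) h" "n = 0 \<longrightarrow> (\<forall>p. h p = 0)"
     "\<forall>p. f p = f (pt_at p u (- l p)) + l p * h p"
     "poly3 (n - 1) h'" "n = 0 \<longrightarrow> (\<forall>p. h' p = 0)"
     "\<forall>p. g p = g (pt_at p u (- l p)) + l p * h' p"
    by blast
  then show ?case
    by (intro exI[of _ "\<lambda>p. h p + h' p"]) (auto intro: poly3.intros simp: algebra_simps)
next
  case (poly3_aff_mult n f c0 c1 c2 c3)
  then obtain h where h: "poly3 (n - 1) h" "n = 0 \<longrightarrow> (\<forall>p. h p = 0)"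
     "\<And>p. f p = f (pt_at p u (- l p)) + l p * h p" by blast
  obtain u1 u2 u3 where u: "u = (u1, u2, u3)" by (cases u)
  have am: "affmap (\<lambda>p. pt_at p u (- l p))"
    by (rule affmapI[of _ "-k0*u1" "1-k1*u1" "-k2*u1" "-k3*u1" "-k0*u2" "-k1*u2" "1-k2*u2" "-k3*u2"
        "-k0*u3" "-k1*u3" "-k2*u3" "1-k3*u3"]) (simp add: u l algebra_simps)
  have "poly3 n (\<lambda>p. aff c0 c1 c2 c3 p * h p)"
    using h(1,2) by (rule poly3_aff_mult_pred)
  then have 1: "poly3 n (\<lambda>p. aff c0 c1 c2 c3 p * h p + (c1*u1+c2*u2+c3*u3) * f (pt_at p u (- l p)))"
    by (intro poly3.poly3_add poly3_cmult poly3_affmap[OF poly3_aff_mult.hyps am])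
  \<comment> \<open>The affine factor changes at the constant rate \<open>c1*u1+c2*u2+c3*u3\<close>
    along \<open>u\<close>; this produces the second summand of the new quotient.\<close>
  have aff: "aff c0 c1 c2 c3 (pt_at p u t) = aff c0 c1 c2 c3 p + t * (c1*u1+c2*u2+c3*u3)" for p t
    by (cases p) (simp add: u algebra_simps)
  have 2: "aff c0 c1 c2 c3 p * f p = aff c0 c1 c2 c3 (pt_at p u (- l p)) * f (pt_at p u (- l p)) + 
     l p * (aff c0 c1 c2 c3 p * h p + (c1*u1+c2*u2+c3*u3) * f (pt_at p u (- l p)))" for p
  proof -
    have "aff c0 c1 c2 c3 p * f p = aff c0 c1 c2 c3 p * (f (pt_at p u (- l p)) + l p * h p)"
      using h(3)[of p] by metis
    then show ?thesis unfolding aff by (simp add: algebra_simps)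
  qed
  show ?case
    by (rule exI, intro conjI allI, simp only: diff_Suc_1, rule 1, simp, rule 2)
qed

section \<open>Restrictions to lines, partial derivatives, expansion along an axis\<close>

lemma degree_linear_mult:
  assumes "degree (r :: 'a::comm_ring_1 poly) \<le> n"
  shows "degree ([:a, b:] * r) \<le> Suc n"
proof -
  have "degree ([:a, b:] * r) \<le> degree [:a, b:] + degree r" by (rule degree_mult_le)
  also have "degree [:a, b:] \<le> 1" by simp
  finally show ?thesis using assms by simp
qed

text \<open>\<open>f1\<close>, \<open>f2\<close>, \<open>f3\<close> are the formal partial
  derivatives. As polynomials are functions here, they are tied to \<open>f\<close> by the chain
  rule for the univariate polynomials \<open>r\<close> obtained on lines. The clause for
  \<open>n = 0\<close> again makes up for truncated subtraction.\<close>

lemma poly3_derivs: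
  assumes "poly3 n (f :: 'a::idom pt \<Rightarrow> 'a)"
  shows "\<exists>f1 f2 f3. poly3 (n - 1) f1 \<and> poly3 (n - 1) f2 \<and> poly3 (n - 1) f3 \<and>
    (n = 0 \<longrightarrow> (\<forall>p. f1 p = 0 \<and> f2 p = 0 \<and> f3 p = 0)) \<and>
    (\<forall>p v. \<exists>r. degree r \<le> n \<and> (\<forall>s. poly r s = f (pt_at p v s)) \<and>
      (\<forall>s. poly (pderiv r) s = fst v * f1 (pt_at p v s) + fst (snd v) * f2 (pt_at p v s)
                             + snd (snd v) * f3 (pt_at p v s)))"
  using assms
proof (induction rule: poly3.induct)
  case (poly3_const n c)
  show ?case
  proof (rule exI[of _ "\<lambda>_. 0"], rule exI[of _ "\<lambda>_. 0"], rule exI[of _ "\<lambda>_. 0"],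
      intro conjI allI impI)
    fix p v :: "'a pt"
    show "\<exists>r. degree r \<le> n \<and> (\<forall>s. poly r s = c) \<and>
      (\<forall>s. poly (pderiv r) s = fst v * 0 + fst (snd v) * 0 + snd (snd v) * 0)"
      by (rule exI[of _ "[:c:]"]) (simp add: pderiv_pCons)
  qed (simp_all add: poly3.poly3_const)
next
  case (poly3_add n f g)
  obtain f1 f2 f3 where f: "poly3 (n - 1) f1" "poly3 (n - 1) f2" "poly3 (n - 1) f3"
    "n = 0 \<longrightarrow> (\<forall>p. f1 p = 0 \<and> f2 p = 0 \<and> f3 p = 0)"
    "\<And>p v. \<exists>r. degree r \<le> n \<and> (\<forall>s. poly r s = f (pt_at p v s)) \<and>
      (\<forall>s. poly (pderiv r) s = fst v * f1 (pt_at p v s) + fst (snd v) * f2 (pt_at p v s)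
                             + snd (snd v) * f3 (pt_at p v s))"
    using poly3_add.IH(1) by blast
  obtain g1 g2 g3 where g: "poly3 (n - 1) g1" "poly3 (n - 1) g2" "poly3 (n - 1) g3"
    "n = 0 \<longrightarrow> (\<forall>p. g1 p = 0 \<and> g2 p = 0 \<and> g3 p = 0)"
    "\<And>p v. \<exists>r. degree r \<le> n \<and> (\<forall>s. poly r s = g (pt_at p v s)) \<and>
      (\<forall>s. poly (pderiv r) s = fst v * g1 (pt_at p v s) + fst (snd v) * g2 (pt_at p v s)
                             + snd (snd v) * g3 (pt_at p v s))"
    using poly3_add.IH(2) by blast
  show ?case
  proof (rule exI[of _ "\<lambda>p. f1 p + g1 p"], rule exI[of _ "\<lambda>p. f2 p + g2 p"],
      rule exI[of _ "\<lambda>p. f3 p + g3 p"], intro conjI allI impI)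
    fix p v :: "'a pt"
    obtain r where r: "degree r \<le> n" "\<And>s. poly r s = f (pt_at p v s)"
      "\<And>s. poly (pderiv r) s = fst v * f1 (pt_at p v s) + fst (snd v) * f2 (pt_at p v s)
                             + snd (snd v) * f3 (pt_at p v s)" using f(5) by metis
    obtain r' where r': "degree r' \<le> n" "\<And>s. poly r' s = g (pt_at p v s)"
      "\<And>s. poly (pderiv r') s = fst v * g1 (pt_at p v s) + fst (snd v) * g2 (pt_at p v s)
                             + snd (snd v) * g3 (pt_at p v s)" using g(5) by metis
    show "\<exists>r. degree r \<le> n \<and> (\<forall>s. poly r s = f (pt_at p v s) + g (pt_at p v s)) \<and>
      (\<forall>s. poly (pderiv r) s = fst v * (f1 (pt_at p v s) + g1 (pt_at p v s)) 
         + fst (snd v) * (f2 (pt_at p v s) + g2 (pt_at p v s))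
         + snd (snd v) * (f3 (pt_at p v s) + g3 (pt_at p v s)))"
      by (rule exI[of _ "r + r'"]) (simp add: r r' pderiv_add distrib_left degree_add_le)
  qed (use f(1-4) g(1-4) in \<open>auto intro: poly3.poly3_add\<close>)
next
  case (poly3_aff_mult n f c0 c1 c2 c3)
  obtain f1 f2 f3 where f: "poly3 (n - 1) f1" "poly3 (n - 1) f2" "poly3 (n - 1) f3"
    "n = 0 \<longrightarrow> (\<forall>p. f1 p = 0 \<and> f2 p = 0 \<and> f3 p = 0)"
    "\<And>p v. \<exists>r. degree r \<le> n \<and> (\<forall>s. poly r s = f (pt_at p v s)) \<and>
      (\<forall>s. poly (pderiv r) s = fst v * f1 (pt_at p v s) + fst (snd v) * f2 (pt_at p v s)
                             + snd (snd v) * f3 (pt_at p v s))"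
    using poly3_aff_mult.IH by blast
  have aux: "poly3 n (\<lambda>p. c * f p + aff c0 c1 c2 c3 p * g p)" 
    if "poly3 (n - 1) g" "n = 0 \<longrightarrow> (\<forall>p. g p = 0)" for g c
  proof -
    have "poly3 n (\<lambda>p. aff c0 c1 c2 c3 p * g p)"
      using that by (rule poly3_aff_mult_pred)
    then show ?thesis by (intro poly3.poly3_add poly3_cmult poly3_aff_mult.hyps)
  qed
  show ?case
  proof (rule exI[of _ "\<lambda>p. c1 * f p + aff c0 c1 c2 c3 p * f1 p"],
      rule exI[of _ "\<lambda>p. c2 * f p + aff c0 c1 c2 c3 p * f2 p"],
      rule exI[of _ "\<lambda>p. c3 * f p + aff c0 c1 c2 c3 p * f3 p"], intro conjI allI impI)
    show "poly3 (Suc n - 1) (\<lambda>p. c1 * f p + aff c0 c1 c2 c3 p * f1 p)"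
      using aux[of f1] f by simp
    show "poly3 (Suc n - 1) (\<lambda>p. c2 * f p + aff c0 c1 c2 c3 p * f2 p)"
      using aux[of f2] f by simp
    show "poly3 (Suc n - 1) (\<lambda>p. c3 * f p + aff c0 c1 c2 c3 p * f3 p)"
      using aux[of f3] f by simp
    fix p v :: "'a pt"
    obtain v1 v2 v3 where v: "v = (v1, v2, v3)" by (cases v)
    obtain r where r: "degree r \<le> n" "\<And>s. poly r s = f (pt_at p v s)"
      "\<And>s. poly (pderiv r) s = fst v * f1 (pt_at p v s) + fst (snd v) * f2 (pt_at p v s)
                             + snd (snd v) * f3 (pt_at p v s)" using f(5) by metis
    have aff: "aff c0 c1 c2 c3 (pt_at p v t) = aff c0 c1 c2 c3 p + t * (c1*v1+c2*v2+c3*v3)" for t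
      by (cases p) (simp add: v algebra_simps)
    show "\<exists>r. degree r \<le> Suc n \<and> 
       (\<forall>s. poly r s = aff c0 c1 c2 c3 (pt_at p v s) * f (pt_at p v s)) \<and>
      (\<forall>s. poly (pderiv r) s = fst v * (c1 * f (pt_at p v s) + aff c0 c1 c2 c3 (pt_at p v s) * f1 (pt_at p v s)) 
         + fst (snd v) * (c2 * f (pt_at p v s) + aff c0 c1 c2 c3 (pt_at p v s) * f2 (pt_at p v s))
         + snd (snd v) * (c3 * f (pt_at p v s) + aff c0 c1 c2 c3 (pt_at p v s) * f3 (pt_at p v s)))"
    proof (rule exI[of _ "[: aff c0 c1 c2 c3 p, c1*v1+c2*v2+c3*v3 :] * r"], intro conjI allI)
      show "degree ([: aff c0 c1 c2 c3 p, c1*v1+c2*v2+c3*v3 :] * r) \<le> Suc n"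
        by (rule degree_linear_mult) (rule r)
      fix s
      have l: "poly [: aff c0 c1 c2 c3 p, c1*v1+c2*v2+c3*v3 :] s = aff c0 c1 c2 c3 (pt_at p v s)"
        by (simp add: aff)
      show "poly ([: aff c0 c1 c2 c3 p, c1*v1+c2*v2+c3*v3 :] * r) s 
          = aff c0 c1 c2 c3 (pt_at p v s) * f (pt_at p v s)"
        by (simp only: poly_mult l r(2))
      have d: "poly (pderiv [: aff c0 c1 c2 c3 p, c1*v1+c2*v2+c3*v3 :]) s = c1*v1+c2*v2+c3*v3"
        by (simp add: pderiv_pCons)
      have *: "K * (v1 * F1 + v2 * F2 + v3 * F3) + F * (c1*v1+c2*v2+c3*v3)
        = v1 * (c1 * F + K * F1) + v2 * (c2 * F + K * F2) + v3 * (c3 * F + K * F3)" for K F F1 F2 F3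
        by (simp add: algebra_simps)
      show "poly (pderiv ([: aff c0 c1 c2 c3 p, c1*v1+c2*v2+c3*v3 :] * r)) s 
         = fst v * (c1 * f (pt_at p v s) + aff c0 c1 c2 c3 (pt_at p v s) * f1 (pt_at p v s)) 
         + fst (snd v) * (c2 * f (pt_at p v s) + aff c0 c1 c2 c3 (pt_at p v s) * f2 (pt_at p v s))
         + snd (snd v) * (c3 * f (pt_at p v s) + aff c0 c1 c2 c3 (pt_at p v s) * f3 (pt_at p v s))"
        using *[of "aff c0 c1 c2 c3 (pt_at p v s)" "f1 (pt_at p v s)" "f2 (pt_at p v s)" "f3 (pt_at p v s)" "f (pt_at p v s)"]
        by (simp only: pderiv_mult poly_mult poly_add l d r(2,3)) (simp add: v)
    qed
  qed auto
qed

lemma poly3_line: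
  assumes "poly3 n (f :: 'a::idom pt \<Rightarrow> 'a)"
  obtains r where "degree r \<le> n" "\<And>s. poly r s = f (pt_at p v s)"
  using poly3_derivs[OF assms] by metis

text \<open>Taylor expansion A(x) + a(x) y + b(x) z + c(x) y^2 + d(x) y z + e(x) z^2 + ... about the
  x-axis, read off along a line through a point of the axis up to second order. \<open>A\<close>,
  \<open>a\<close>, \<open>b\<close> are polynomials because they get differentiated; of the
  second-order coefficients only values matter. \<open>A2\<close> stands for A''/2 without a
  division by 2.\<close>

lemma poly3_axis_expansion:
  assumes "poly3 n (g :: 'a::idom pt \<Rightarrow> 'a)"
  shows "\<exists>A a b A2 c d e. degree A \<le> n \<and> degree a \<le> n \<and> degree b \<le> n \<and>
     (\<forall>x \<alpha> \<beta> \<gamma>. \<exists>r. degree r \<le> n \<and> (\<forall>s. poly r s = g (x + s * \<alpha>, s * \<beta>, s * \<gamma>)) \<and>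
       coeff r 0 = poly A x \<and>
       coeff r 1 = \<alpha> * poly (pderiv A) x + \<beta> * poly a x + \<gamma> * poly b x \<and>
       coeff r 2 = \<alpha>\<^sup>2 * A2 x + \<alpha> * (\<beta> * poly (pderiv a) x + \<gamma> * poly (pderiv b) x)
         + c x * \<beta>\<^sup>2 + d x * \<beta> * \<gamma> + e x * \<gamma>\<^sup>2)"
  using assms
proof (induction rule: poly3.induct)
  case (poly3_const n k)
  show ?case
  proof (rule exI[of _ "[:k:]"], rule exI[of _ 0], rule exI[of _ 0], rule exI[of _ "\<lambda>_. 0"],
      rule exI[of _ "\<lambda>_. 0"], rule exI[of _ "\<lambda>_. 0"], rule exI[of _ "\<lambda>_. 0"], intro conjI allI)
    fix x \<alpha> \<beta> \<gamma>
    show "\<exists>r. degree r \<le> n \<and> (\<forall>s. poly r s = k) \<and>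
       coeff r 0 = poly [:k:] x \<and>
       coeff r 1 = \<alpha> * poly (pderiv [:k:]) x + \<beta> * poly 0 x + \<gamma> * poly 0 x \<and>
       coeff r 2 = \<alpha>\<^sup>2 * 0 + \<alpha> * (\<beta> * poly (pderiv 0) x + \<gamma> * poly (pderiv 0) x)
         + 0 * \<beta>\<^sup>2 + 0 * \<beta> * \<gamma> + 0 * \<gamma>\<^sup>2"
      by (rule exI[of _ "[:k:]"]) (simp add: pderiv_pCons numeral_2_eq_2)
  qed simp_all
next
  case (poly3_add n f g)
  obtain A a b A2 c d e where f: "degree A \<le> n" "degree a \<le> n" "degree b \<le> n"
     "\<And>x \<alpha> \<beta> \<gamma>. \<exists>r. degree r \<le> n \<and> (\<forall>s. poly r s = f (x + s * \<alpha>, s * \<beta>, s * \<gamma>)) \<and>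
       coeff r 0 = poly A x \<and>
       coeff r 1 = \<alpha> * poly (pderiv A) x + \<beta> * poly a x + \<gamma> * poly b x \<and>
       coeff r 2 = \<alpha>\<^sup>2 * A2 x + \<alpha> * (\<beta> * poly (pderiv a) x + \<gamma> * poly (pderiv b) x)
         + c x * \<beta>\<^sup>2 + d x * \<beta> * \<gamma> + e x * \<gamma>\<^sup>2"
    using poly3_add.IH(1) by blast
  obtain A' a' b' A2' c' d' e' where g: "degree A' \<le> n" "degree a' \<le> n" "degree b' \<le> n"
     "\<And>x \<alpha> \<beta> \<gamma>. \<exists>r. degree r \<le> n \<and> (\<forall>s. poly r s = g (x + s * \<alpha>, s * \<beta>, s * \<gamma>)) \<and>
       coeff r 0 = poly A' x \<and>
       coeff r 1 = \<alpha> * poly (pderiv A') x + \<beta> * poly a' x + \<gamma> * poly b' x \<and>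
       coeff r 2 = \<alpha>\<^sup>2 * A2' x + \<alpha> * (\<beta> * poly (pderiv a') x + \<gamma> * poly (pderiv b') x)
         + c' x * \<beta>\<^sup>2 + d' x * \<beta> * \<gamma> + e' x * \<gamma>\<^sup>2"
    using poly3_add.IH(2) by blast
  show ?case
  proof (rule exI[of _ "A + A'"], rule exI[of _ "a + a'"], rule exI[of _ "b + b'"],
     rule exI[of _ "\<lambda>x. A2 x + A2' x"], rule exI[of _ "\<lambda>x. c x + c' x"], 
     rule exI[of _ "\<lambda>x. d x + d' x"], rule exI[of _ "\<lambda>x. e x + e' x"], intro conjI allI)
    fix x \<alpha> \<beta> \<gamma>
    obtain r where r: "degree r \<le> n" "\<forall>s. poly r s = f (x + s * \<alpha>, s * \<beta>, s * \<gamma>)"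
       "coeff r 0 = poly A x"
       "coeff r 1 = \<alpha> * poly (pderiv A) x + \<beta> * poly a x + \<gamma> * poly b x"
       "coeff r 2 = \<alpha>\<^sup>2 * A2 x + \<alpha> * (\<beta> * poly (pderiv a) x + \<gamma> * poly (pderiv b) x)
         + c x * \<beta>\<^sup>2 + d x * \<beta> * \<gamma> + e x * \<gamma>\<^sup>2" using f(4) by metis
    obtain r' where r': "degree r' \<le> n" "\<forall>s. poly r' s = g (x + s * \<alpha>, s * \<beta>, s * \<gamma>)"
       "coeff r' 0 = poly A' x"
       "coeff r' 1 = \<alpha> * poly (pderiv A') x + \<beta> * poly a' x + \<gamma> * poly b' x"
       "coeff r' 2 = \<alpha>\<^sup>2 * A2' x + \<alpha> * (\<beta> * poly (pderiv a') x + \<gamma> * poly (pderiv b') x)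
         + c' x * \<beta>\<^sup>2 + d' x * \<beta> * \<gamma> + e' x * \<gamma>\<^sup>2" using g(4) by metis
    show "\<exists>r. degree r \<le> n \<and> (\<forall>s. poly r s = f (x + s * \<alpha>, s * \<beta>, s * \<gamma>) + g (x + s * \<alpha>, s * \<beta>, s * \<gamma>)) \<and>
       coeff r 0 = poly (A + A') x \<and>
       coeff r 1 = \<alpha> * poly (pderiv (A + A')) x + \<beta> * poly (a + a') x + \<gamma> * poly (b + b') x \<and>
       coeff r 2 = \<alpha>\<^sup>2 * (A2 x + A2' x) + \<alpha> * (\<beta> * poly (pderiv (a + a')) x + \<gamma> * poly (pderiv (b + b')) x)
         + (c x + c' x) * \<beta>\<^sup>2 + (d x + d' x) * \<beta> * \<gamma> + (e x + e' x) * \<gamma>\<^sup>2"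
      by (rule exI[of _ "r + r'"], intro conjI)
        (use r r' in \<open>simp_all add: pderiv_add algebra_simps degree_add_le\<close>)
  qed (use f(1-3) g(1-3) in \<open>auto intro: degree_add_le\<close>)
next
  case (poly3_aff_mult n f c0 c1 c2 c3)
  obtain A a b A2 c d e where f: "degree A \<le> n" "degree a \<le> n" "degree b \<le> n"
     "\<And>x \<alpha> \<beta> \<gamma>. \<exists>r. degree r \<le> n \<and> (\<forall>s. poly r s = f (x + s * \<alpha>, s * \<beta>, s * \<gamma>)) \<and>
       coeff r 0 = poly A x \<and>
       coeff r 1 = \<alpha> * poly (pderiv A) x + \<beta> * poly a x + \<gamma> * poly b x \<and>
       coeff r 2 = \<alpha>\<^sup>2 * A2 x + \<alpha> * (\<beta> * poly (pderiv a) x + \<gamma> * poly (pderiv b) x)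
         + c x * \<beta>\<^sup>2 + d x * \<beta> * \<gamma> + e x * \<gamma>\<^sup>2"
    using poly3_aff_mult.IH(1) by blast
  define k where "k = [:c0, c1:]"
  show ?case
  proof (rule exI[of _ "k * A"], rule exI[of _ "k * a + smult c2 A"], rule exI[of _ "k * b + smult c3 A"],
     rule exI[of _ "\<lambda>x. poly k x * A2 x + c1 * poly (pderiv A) x"], 
     rule exI[of _ "\<lambda>x. poly k x * c x + c2 * poly a x"], 
     rule exI[of _ "\<lambda>x. poly k x * d x + c2 * poly b x + c3 * poly a x"], 
     rule exI[of _ "\<lambda>x. poly k x * e x + c3 * poly b x"], intro conjI allI)
    fix x \<alpha> \<beta> \<gamma>
    obtain r where r: "degree r \<le> n" "\<And>s. poly r s = f (x + s * \<alpha>, s * \<beta>, s * \<gamma>)"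
       "coeff r 0 = poly A x"
       "coeff r 1 = \<alpha> * poly (pderiv A) x + \<beta> * poly a x + \<gamma> * poly b x"
       "coeff r 2 = \<alpha>\<^sup>2 * A2 x + \<alpha> * (\<beta> * poly (pderiv a) x + \<gamma> * poly (pderiv b) x)
         + c x * \<beta>\<^sup>2 + d x * \<beta> * \<gamma> + e x * \<gamma>\<^sup>2" using f(4) by metis
    define l where "l = [:c0 + c1 * x, c1 * \<alpha> + c2 * \<beta> + c3 * \<gamma>:]"
    have co: "coeff (l * r) 0 = (c0 + c1 * x) * coeff r 0"
       "coeff (l * r) 1 = (c0 + c1 * x) * coeff r 1 + (c1 * \<alpha> + c2 * \<beta> + c3 * \<gamma>) * coeff r 0"
       "coeff (l * r) 2 = (c0 + c1 * x) * coeff r 2 + (c1 * \<alpha> + c2 * \<beta> + c3 * \<gamma>) * coeff r 1"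
      by (simp_all add: l_def numeral_2_eq_2 mult_pCons_left)
    show "\<exists>r. degree r \<le> Suc n \<and> (\<forall>s. poly r s = aff c0 c1 c2 c3 (x + s * \<alpha>, s * \<beta>, s * \<gamma>) * f (x + s * \<alpha>, s * \<beta>, s * \<gamma>)) \<and>
       coeff r 0 = poly (k * A) x \<and>
       coeff r 1 = \<alpha> * poly (pderiv (k * A)) x + \<beta> * poly (k * a + smult c2 A) x + \<gamma> * poly (k * b + smult c3 A) x \<and>
       coeff r 2 = \<alpha>\<^sup>2 * (poly k x * A2 x + c1 * poly (pderiv A) x) + \<alpha> * (\<beta> * poly (pderiv (k * a + smult c2 A)) x + \<gamma> * poly (pderiv (k * b + smult c3 A)) x)
         + (poly k x * c x + c2 * poly a x) * \<beta>\<^sup>2 + (poly k x * d x + c2 * poly b x + c3 * poly a x) * \<beta> * \<gamma> + (poly k x * e x + c3 * poly b x) * \<gamma>\<^sup>2"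
    proof (rule exI[of _ "l * r"], intro conjI allI)
      show "degree (l * r) \<le> Suc n" unfolding l_def by (rule degree_linear_mult) (rule r)
      show "poly (l * r) s = aff c0 c1 c2 c3 (x + s * \<alpha>, s * \<beta>, s * \<gamma>) * f (x + s * \<alpha>, s * \<beta>, s * \<gamma>)" for s
        by (simp add: r(2) l_def algebra_simps)
    qed (simp_all only: co r(3-5), simp_all add: k_def pderiv_mult pderiv_add pderiv_pCons pderiv_smult power2_eq_square algebra_simps)
  next
    have "degree (k * A) \<le> Suc n" "degree (k * a) \<le> Suc n" "degree (k * b) \<le> Suc n"
      unfolding k_def using f by (auto intro: degree_linear_mult simp del: mult_pCons_left)
    moreover have "degree (smult t A) \<le> Suc n" for t using f(1) degree_smult_le[of t A] by linarith
    ultimately show "degree (k * A) \<le> Suc n" "degree (k * a + smult c2 A) \<le> Suc n" 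
       "degree (k * b + smult c3 A) \<le> Suc n" by (auto intro: degree_add_le)
  qed
qed

section \<open>Flat lines on a surface\<close>

lemma of_nat_neq_0_char:
  assumes "0 < n" "n < CHAR('a::semiring_1)"
  shows "(of_nat n :: 'a) \<noteq> 0"
  using assms by (auto simp: of_nat_eq_0_iff_char_dvd dest: dvd_imp_le)

lemma degree_pderiv_char:
  fixes p :: "'a::idom poly"
  assumes "degree p < CHAR('a)"
  shows "degree (pderiv p) = degree p - 1"
proof (cases "degree p")
  case 0
  then obtain c where "p = [:c:]" by (metis degree_eq_zeroE)
  then show ?thesis by (simp add: pderiv_pCons)
next
  case (Suc d)
  have "degree (pderiv p) \<le> d"
    by (rule degree_le) (auto simp: coeff_pderiv coeff_eq_0 Suc)
  moreover have "coeff (pderiv p) d \<noteq> 0"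
    using of_nat_neq_0_char[of "Suc d", where ?'a = 'a] assms Suc
    by (auto simp: coeff_pderiv simp del: of_nat_Suc) (metis Suc leading_coeff_0_iff degree_0 nat.distinct(1))
  ultimately show ?thesis using Suc le_degree[of "pderiv p" d] by simp
qed

lemma pderiv_eq_0_char:
  fixes p :: "'a::idom poly"
  assumes "degree p < CHAR('a)" "pderiv p = 0"
  shows "degree p = 0"
proof (rule ccontr)
  assume "degree p \<noteq> 0"
  then obtain d where d: "degree p = Suc d" by (cases "degree p") auto
  then have "coeff (pderiv p) d \<noteq> 0"
    using of_nat_neq_0_char[of "Suc d", where ?'a = 'a] assms(1)
    by (auto simp: coeff_pderiv simp del: of_nat_Suc) (metis d leading_coeff_0_iff degree_0 nat.distinct(1))
  with assms(2) show False by simp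
qed

lemma lead_coeff_pderiv_char:
  fixes p :: "'a::idom poly"
  assumes "degree p < CHAR('a)" 
  shows "lead_coeff (pderiv p) = of_nat (degree p) * lead_coeff p"
proof (cases "degree p")
  case 0
  then obtain c where "p = [:c:]" by (metis degree_eq_zeroE)
  then show ?thesis by (simp add: pderiv_pCons)
qed (simp add: degree_pderiv_char[OF assms] coeff_pderiv)

text \<open>Comparing leading coefficients shows that the degrees agree modulo the characteristic;
  both are smaller than it, hence equal.\<close>

lemma wronskian_zero_degree_eq:
  fixes a b :: "'a::idom poly"
  assumes "degree a < CHAR('a)" "degree b < CHAR('a)" "a \<noteq> 0" "b \<noteq> 0"
    and W: "a * pderiv b = pderiv a * b"
  shows "degree a = degree b"
proof -
  have "lead_coeff (a * pderiv b) = lead_coeff (pderiv a * b)" using W by simp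
  then have "of_nat (degree b) * (lead_coeff a * lead_coeff b) = of_nat (degree a) * (lead_coeff a * lead_coeff b)"
    using assms(1,2) by (simp only: lead_coeff_mult lead_coeff_pderiv_char ac_simps)
  then have "of_nat (degree b) = (of_nat (degree a) :: 'a)" using assms(3,4) by simp
  then have "[degree b = degree a] (mod CHAR('a))" by (simp add: of_nat_eq_iff_cong_CHAR)
  then show ?thesis using assms(1,2) by (simp add: cong_def)
qed

text \<open>Cancelling the leading term of \<open>b\<close> against \<open>a\<close> leaves a
  polynomial of smaller degree, or zero, whose Wronskian with \<open>a\<close> is still zero; the
  previous lemma excludes a nonzero one. Without the degree bounds, 1 and x^p are a
  counterexample.\<close>

lemma wronskian_zero_proportional:
  fixes a b :: "'a::field poly"
  assumes "degree a < CHAR('a)" "degree b < CHAR('a)" "a \<noteq> 0"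
    and W: "a * pderiv b = pderiv a * b"
  shows "\<exists>k. b = smult k a"
proof (cases "b = 0")
  case True
  then show ?thesis by (auto intro: exI[of _ 0])
next
  case False
  have deg: "degree a = degree b"
    using assms(1-3) False W by (rule wronskian_zero_degree_eq)
  define k where "k = lead_coeff b / lead_coeff a"
  define c where "c = b - smult k a"
  have "coeff b (degree a) = lead_coeff b" by (simp add: deg)
  then have "coeff c (degree a) = 0" using assms(3) by (simp add: c_def k_def)
  have dc: "degree c \<le> degree a" unfolding c_def
    by (rule degree_diff_le) (simp_all add: deg)
  have Wc: "a * pderiv c = pderiv a * c"
    by (simp add: c_def pderiv_diff pderiv_smult right_diff_distrib W) (simp add: mult.commute)
  have "c = 0"
  proof (rule ccontr)
    assume "c \<noteq> 0"
    have "degree c < CHAR('a)" using dc assms(1) by linarith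
    then have "degree a = degree c"
      by (rule wronskian_zero_degree_eq[OF assms(1) _ assms(3) \<open>c \<noteq> 0\<close> Wc])
    with \<open>coeff c (degree a) = 0\<close> \<open>c \<noteq> 0\<close> show False by simp
  qed
  then show ?thesis unfolding c_def by auto
qed

text \<open>For each fixed \<open>z\<close> this is a plane statement: a curve of degree
  \<open>n\<close> cannot contain more than \<open>n\<close> lines crossing the x-axis at distinct
  points. Such an \<open>f\<close> has more than \<open>n\<close> zeros on the axis, so y divides
  it, and the quotient, of lower degree, contains the same lines.\<close>

lemma poly3_0_if_transversals:
  fixes f :: "'a::{field,finite} pt \<Rightarrow> 'a"
  assumes "poly3 n f" "n < card T" "n < CARD('a)"
    and "\<And>t. t \<in> T \<Longrightarrow> \<exists>\<alpha>. \<forall>s z. f (t + s * \<alpha>, s, z) = 0"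
  shows "f p = 0"
  using assms
proof (induction n arbitrary: f p)
  case 0
  obtain c where "\<forall>p. f p = c" using poly3_0_const[OF 0(1)] by blast
  moreover obtain t where "t \<in> T" using 0 by fastforce
  ultimately show ?case using 0 by metis
next
  case (Suc n)
  obtain h where h: "poly3 n h" and fh': "\<forall>p. f p = f (pt_at p (0,1,0) (- aff 0 0 1 0 p)) + aff 0 0 1 0 p * h p"
    using poly3_div_aff[OF Suc.prems(1) refl, where u = "(0,1,0)" and ?k0.0 = 0 and ?k1.0 = 0 and ?k2.0 = 1 and ?k3.0 = 0] unfolding diff_Suc_1 by blast
  have f0: "f (x, 0, z) = 0" for x z
  proof -
    obtain r where r: "degree r \<le> Suc n" "\<And>s. poly r s = f (pt_at (0,0,z) (1,0,0) s)"
      using poly3_line[OF Suc.prems(1)] by metis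
    have "poly r t = 0" if t: "t \<in> T" for t
    proof -
      obtain \<alpha> where "\<forall>s z. f (t + s * \<alpha>, s, z) = 0" using Suc.prems(4)[OF t] by blast
      then have "f (t + 0 * \<alpha>, 0, z) = 0" by blast
      then show ?thesis by (simp add: r)
    qed
    then have "r = 0" using r Suc.prems(2)
      by (intro poly_eqI_degree[of T]) auto
    then show ?thesis using r(2)[of x] by simp
  qed
  have fh: "f (x, y, z) = y * h (x, y, z)" for x y z
    using spec[OF fh', of "(x,y,z)"] by (simp add: f0)
  have "h p = 0" for p
  proof (rule Suc.IH[OF h])
    fix t assume "t \<in> T"
    then obtain \<alpha> where \<alpha>: "\<And>s z. f (t + s * \<alpha>, s, z) = 0" using Suc.prems(4) by blast
    have "h (t + s * \<alpha>, s, z) = 0" for s z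
    proof -
      obtain r where r: "degree r \<le> n" "\<And>s. poly r s = h (pt_at (t,0,z) (\<alpha>,1,0) s)"
        using poly3_line[OF h] by metis
      have "r = 0"
      \<comment> \<open>At \<open>s = 0\<close> the factor y vanishes and says nothing about
        \<open>h\<close>. The other q - 1 points still exceed the degree, because
        \<open>Suc n\<close> is below q.\<close>
      proof (rule poly_eqI_degree[of "UNIV - {0}"])
        show "poly r x = poly 0 x" if "x \<in> UNIV - {0}" for x
          using \<alpha>[of x z] that by (simp add: r fh)
        show "degree r < card (UNIV - {0::'a})" "degree (0::'a poly) < card (UNIV - {0::'a})" 
          using r Suc.prems(3) by (simp_all add: card_Diff_singleton)
      qed
      then show ?thesis using r(2)[of s] by simp
    qed
    then show "\<exists>\<alpha>. \<forall>s z. h (t + s * \<alpha>, s, z) = 0" by blast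
  qed (use Suc.prems in auto)
  then show ?case by (cases p) (simp add: fh)
qed

text \<open>The first four hypotheses are the coefficients of \<open>s\<close> and \<open>s\<^sup>2\<close> in the restriction of
  \<open>a(x) y + b(x) z + c(x) y\<^sup>2 + d(x) y z + e(x) z\<^sup>2 + \<dots>\<close> to two lines through a point of the \<open>x\<close>-axis.\<close>

lemma wronskian_from_two_lines:
  fixes a b :: "'a::field"
  assumes "\<beta>1 * a + \<gamma>1 * b = 0" "\<beta>2 * a + \<gamma>2 * b = 0"
    and "\<alpha>1 * (\<beta>1 * a' + \<gamma>1 * b') + c * \<beta>1\<^sup>2 + d * \<beta>1 * \<gamma>1 + e * \<gamma>1\<^sup>2 = 0"
    and "\<alpha>2 * (\<beta>2 * a' + \<gamma>2 * b') + c * \<beta>2\<^sup>2 + d * \<beta>2 * \<gamma>2 + e * \<gamma>2\<^sup>2 = 0"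
    and nz: "(\<beta>1, \<gamma>1) \<noteq> (0, 0)" "(\<beta>2, \<gamma>2) \<noteq> (0, 0)"
    and indep: "\<And>k. (\<alpha>2, \<beta>2, \<gamma>2) \<noteq> (k * \<alpha>1, k * \<beta>1, k * \<gamma>1)"
  shows "a * b' = a' * b"
proof (cases "a = 0 \<and> b = 0")
  case False
  \<comment> \<open>The solutions of one nonzero linear equation in two unknowns are the multiples
    of (b, -a).\<close>
  have ex: "\<exists>k. \<beta> = k * b \<and> \<gamma> = - k * a" if "\<beta> * a + \<gamma> * b = 0" for \<beta> \<gamma>
  proof (cases "a = 0")
    case True
    with False that show ?thesis by (intro exI[of _ "\<beta> / b"]) auto
  next
    case a: False
    from that have "\<beta> * a = - (\<gamma> * b)" by (simp add: eq_neg_iff_add_eq_0)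
    then have "\<beta> = - (\<gamma> * b) / a" using a by (metis nonzero_mult_div_cancel_right)
    with a show ?thesis by (intro exI[of _ "- \<gamma> / a"]) simp
  qed
  obtain k1 where k1: "\<beta>1 = k1 * b" "\<gamma>1 = - k1 * a" using ex assms(1) by blast
  obtain k2 where k2: "\<beta>2 = k2 * b" "\<gamma>2 = - k2 * a" using ex assms(2) by blast
  have k: "k1 \<noteq> 0" "k2 \<noteq> 0" using nz k1 k2 by auto
  define W where "W = a * b' - a' * b"
  define C where "C = c * b\<^sup>2 - d * a * b + e * a\<^sup>2"
  \<comment> \<open>After substitution the second-order equations become linear relations between
    \<open>k1\<close>, \<open>\<alpha>1\<close> and between \<open>k2\<close>,
    \<open>\<alpha>2\<close>. A nonzero \<open>W\<close> would give both pairs the same ratio and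
    make the two lines parallel.\<close>
  have "k1 * (k1 * C - \<alpha>1 * W) = 0" using assms(3) unfolding k1 W_def C_def
    by (simp add: algebra_simps power2_eq_square)
  then have 1: "k1 * C = \<alpha>1 * W" using k by simp
  have "k2 * (k2 * C - \<alpha>2 * W) = 0" using assms(4) unfolding k2 W_def C_def
    by (simp add: algebra_simps power2_eq_square)
  then have 2: "k2 * C = \<alpha>2 * W" using k by simp
  have "W = 0"
  proof (rule ccontr)
    assume "W \<noteq> 0"
    have "k1 * (k2 * C) = k2 * (k1 * C)" by (rule mult.left_commute)
    then have "(k1 * \<alpha>2) * W = (k2 * \<alpha>1) * W" unfolding 1 2 by (simp only: mult.assoc)
    then have "k1 * \<alpha>2 = k2 * \<alpha>1" using \<open>W \<noteq> 0\<close> by simp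
    then have "\<alpha>2 = (k2 / k1) * \<alpha>1" using k by (simp add: eq_divide_eq mult.commute)
    then show False using indep[of "k2 / k1"] k1 k2 k by simp
  qed
  then show ?thesis by (simp add: W_def)
qed auto

text \<open>The Wronskian of \<open>a\<close> and \<open>b\<close> has degree at most 2 n and
  vanishes on \<open>T\<close>, which has more than q / 2 > 3 n elements; so the tangent plane is
  the same at all regular points of the axis. Lines through those points lie in it, and there are
  enough of them for \<open>poly3_0_if_transversals\<close>. The data \<open>r0\<close>,
  \<open>x0\<close> say that some point of the axis is regular.\<close>

lemma flat_axis_in_plane:
  fixes g :: "'a::{field,finite} pt \<Rightarrow> 'a"
  assumes g: "poly3 n g" and n: "6 * n < CARD('a)" and char: "CHAR('a) = CARD('a)"
    and axis: "\<And>x. g (x, 0, 0) = 0"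
    and nz: "degree r0 \<le> n" "\<And>s. poly r0 s = g (x0 + s * \<alpha>0, s * \<beta>0, s * \<gamma>0)" "coeff r0 1 \<noteq> 0"
    and T: "CARD('a) < 2 * card T"
    and flat: "\<And>t. t \<in> T \<Longrightarrow> \<exists>\<alpha>1 \<beta>1 \<gamma>1 \<alpha>2 \<beta>2 \<gamma>2. (\<beta>1, \<gamma>1) \<noteq> (0, 0) \<and> (\<beta>2, \<gamma>2) \<noteq> (0, 0) \<and>
        (\<forall>k. (\<alpha>2, \<beta>2, \<gamma>2) \<noteq> (k * \<alpha>1, k * \<beta>1, k * \<gamma>1)) \<and>
        (\<forall>s. g (t + s * \<alpha>1, s * \<beta>1, s * \<gamma>1) = 0) \<and> (\<forall>s. g (t + s * \<alpha>2, s * \<beta>2, s * \<gamma>2) = 0)"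
  shows "\<exists>y0 z0. (y0, z0) \<noteq> (0, 0) \<and> (\<forall>x s. g (x, s * y0, s * z0) = 0)"
proof -
  obtain A a b A2 c d e where deg: "degree A \<le> n" "degree a \<le> n" "degree b \<le> n"
     and ex: "\<And>x \<alpha> \<beta> \<gamma>. \<exists>r. degree r \<le> n \<and> (\<forall>s. poly r s = g (x + s * \<alpha>, s * \<beta>, s * \<gamma>)) \<and>
       coeff r 0 = poly A x \<and>
       coeff r 1 = \<alpha> * poly (pderiv A) x + \<beta> * poly a x + \<gamma> * poly b x \<and>
       coeff r 2 = \<alpha>\<^sup>2 * A2 x + \<alpha> * (\<beta> * poly (pderiv a) x + \<gamma> * poly (pderiv b) x)
         + c x * \<beta>\<^sup>2 + d x * \<beta> * \<gamma> + e x * \<gamma>\<^sup>2"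
    using poly3_axis_expansion[OF g] by blast
  have nq: "n < CARD('a)" using n by linarith
  have "A = 0"
  proof (rule poly_eqI_degree[of UNIV])
    show "poly A x = poly 0 x" for x
    proof -
      obtain r where r: "\<forall>s. poly r s = g (x + s * 0, s * 0, s * 0)" "coeff r 0 = poly A x"
        using ex[of x 0 0 0] by blast
      have "poly r 0 = 0" using r(1) axis[of x] by simp
      with r(2) show ?thesis by (simp add: poly_0_coeff_0)
    qed
  qed (use deg nq in auto)
  have uniq: "r = r'" if "degree r \<le> n" "degree r' \<le> n" "\<And>s. poly r s = poly r' s" for r r' :: "'a poly"
    by (rule poly_eqI_degree[of UNIV]) (use that nq in auto)
  have r2: "\<alpha>\<^sup>2 * A2 x + \<alpha> * (\<beta> * poly (pderiv a) x + \<gamma> * poly (pderiv b) x)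
         + c x * \<beta>\<^sup>2 + d x * \<beta> * \<gamma> + e x * \<gamma>\<^sup>2 = 0" 
    and r1: "\<beta> * poly a x + \<gamma> * poly b x = 0"
    if *: "\<And>s. g (x + s * \<alpha>, s * \<beta>, s * \<gamma>) = 0" for x \<alpha> \<beta> \<gamma>
  proof -
    obtain r where r: "degree r \<le> n" "\<forall>s. poly r s = g (x + s * \<alpha>, s * \<beta>, s * \<gamma>)"
       "coeff r 1 = \<alpha> * poly (pderiv A) x + \<beta> * poly a x + \<gamma> * poly b x"
       "coeff r 2 = \<alpha>\<^sup>2 * A2 x + \<alpha> * (\<beta> * poly (pderiv a) x + \<gamma> * poly (pderiv b) x)
         + c x * \<beta>\<^sup>2 + d x * \<beta> * \<gamma> + e x * \<gamma>\<^sup>2" using ex[of x \<alpha> \<beta> \<gamma>] by metis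
    have "r = 0" by (rule uniq) (use r(1,2) * in simp_all)
    with r show "\<alpha>\<^sup>2 * A2 x + \<alpha> * (\<beta> * poly (pderiv a) x + \<gamma> * poly (pderiv b) x)
         + c x * \<beta>\<^sup>2 + d x * \<beta> * \<gamma> + e x * \<gamma>\<^sup>2 = 0" "\<beta> * poly a x + \<gamma> * poly b x = 0"
      by (simp_all add: \<open>A = 0\<close>)
  qed
  \<comment> \<open>The direction (1, 0, 0) stays on the axis and isolates the pure second-order
    term.\<close>
  have A2: "A2 x = 0" for x using r2[of x 1 0 0] by (simp add: axis)
  have W: "a * pderiv b = pderiv a * b"
  proof (rule poly_eqI_degree[of T])
    show "poly (a * pderiv b) t = poly (pderiv a * b) t" if t: "t \<in> T" for t
    proof -
      obtain \<alpha>1 \<beta>1 \<gamma>1 \<alpha>2 \<beta>2 \<gamma>2 where **: "(\<beta>1, \<gamma>1) \<noteq> (0, 0)" "(\<beta>2, \<gamma>2) \<noteq> (0, 0)"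
        "\<forall>k. (\<alpha>2, \<beta>2, \<gamma>2) \<noteq> (k * \<alpha>1, k * \<beta>1, k * \<gamma>1)"
        "\<forall>s. g (t + s * \<alpha>1, s * \<beta>1, s * \<gamma>1) = 0" "\<forall>s. g (t + s * \<alpha>2, s * \<beta>2, s * \<gamma>2) = 0"
        using flat[OF t] by (elim exE conjE) (rule that; assumption)
      note * = **(1,2) **(3)[rule_format] **(4)[rule_format] **(5)[rule_format]
      have "poly a t * poly (pderiv b) t = poly (pderiv a) t * poly b t"
      proof (rule wronskian_from_two_lines[OF r1[OF *(4)] r1[OF *(5)] _ _ *(1,2,3)])
        show "\<alpha>1 * (\<beta>1 * poly (pderiv a) t + \<gamma>1 * poly (pderiv b) t)
         + c t * \<beta>1\<^sup>2 + d t * \<beta>1 * \<gamma>1 + e t * \<gamma>1\<^sup>2 = 0"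
          using r2[OF *(4)] by (simp add: A2)
        show "\<alpha>2 * (\<beta>2 * poly (pderiv a) t + \<gamma>2 * poly (pderiv b) t)
         + c t * \<beta>2\<^sup>2 + d t * \<beta>2 * \<gamma>2 + e t * \<gamma>2\<^sup>2 = 0"
          using r2[OF *(5)] by (simp add: A2)
      qed
      then show ?thesis by simp
    qed
    have "degree (a * pderiv b) \<le> degree a + degree (pderiv b)"
       "degree (pderiv a * b) \<le> degree (pderiv a) + degree b" by (rule degree_mult_le)+
    moreover have "degree (pderiv a) \<le> n" "degree (pderiv b) \<le> n"
      using deg nq char by (simp_all add: degree_pderiv_char)
    ultimately show "degree (a * pderiv b) < card T" "degree (pderiv a * b) < card T"
      using deg T n by linarith+
  qed
  have ab: "a \<noteq> 0 \<or> b \<noteq> 0"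
  proof (rule ccontr)
    assume "\<not> (a \<noteq> 0 \<or> b \<noteq> 0)"
    moreover obtain r where r: "degree r \<le> n" "\<forall>s. poly r s = g (x0 + s * \<alpha>0, s * \<beta>0, s * \<gamma>0)"
       "coeff r 1 = \<alpha>0 * poly (pderiv A) x0 + \<beta>0 * poly a x0 + \<gamma>0 * poly b x0"
      using ex[of x0 \<alpha>0 \<beta>0 \<gamma>0] by metis
    moreover have "r = r0" by (rule uniq) (use r(1,2) nz(1,2) in simp_all)
    ultimately show False using nz(3) \<open>A = 0\<close> by simp
  qed
  \<comment> \<open>With (a, b) = B (-z0, y0) the linear term a y + b z vanishes at (y, z) = (y0,
    z0): this is the common tangent direction transversal to the axis. The factor \<open>B\<close>
    vanishes exactly at the singular points of the axis.\<close>
  obtain B y0 z0 where B: "B \<noteq> 0" "degree B \<le> n" "a = smult (- z0) B" "b = smult y0 B" "(y0, z0) \<noteq> (0,0)"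
  proof (cases "a = 0")
    case True
    then show ?thesis using that[of b 0 1] ab deg by simp
  next
    case False
    then obtain k where "b = smult k a" 
      using wronskian_zero_proportional[OF _ _ False W] deg nq char by auto
    then show ?thesis using that[of a "-1" k] False deg by simp
  qed
  define \<Theta> where "\<Theta> = {t \<in> T. poly B t \<noteq> 0}"
  have "card {t. poly B t = 0} \<le> n" using card_poly_roots_bound[OF B(1)] B(2) by linarith
  moreover have "card T \<le> card (\<Theta> \<union> {t. poly B t = 0})"
    by (rule card_mono) (auto simp: \<Theta>_def)
  moreover have "card (\<Theta> \<union> {t. poly B t = 0}) \<le> card \<Theta> + card {t. poly B t = 0}"
    by (rule card_Un_le)
  ultimately have \<Theta>: "n < card \<Theta>" using T n by linarith
  \<comment> \<open>Restriction of \<open>g\<close> to the candidate plane, with coordinates x and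
    the multiple of (y0, z0); the third coordinate is ignored.\<close>
  define g2 :: "'a pt \<Rightarrow> 'a" where "g2 = (\<lambda>p. g (fst p, y0 * fst (snd p), z0 * fst (snd p)))"
  have "poly3 n g2" unfolding g2_def
    by (rule poly3_affmap[OF g], rule affmapI[of _ 0 1 0 0 0 0 y0 0 0 0 z0 0]) simp
  then have g0: "g2 p = 0" for p
  proof (rule poly3_0_if_transversals[OF _ \<Theta> nq])
    fix t assume t: "t \<in> \<Theta>"
    then have "t \<in> T" by (simp add: \<Theta>_def)
    from flat[OF this] obtain \<alpha> \<beta> \<gamma> where **: "(\<beta>, \<gamma>) \<noteq> (0, 0)" "\<forall>s. g (t + s * \<alpha>, s * \<beta>, s * \<gamma>) = 0"
      by (elim exE conjE) (rule that; assumption)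
    note * = **(1) **(2)[rule_format]
    \<comment> \<open>The first-order condition puts the line into the tangent plane as soon as
      \<open>B\<close> is nonzero at \<open>t\<close>.\<close>
    have "(\<gamma> * y0 - \<beta> * z0) * poly B t = 0" using r1[OF *(2)] by (simp add: B algebra_simps)
    then have eq: "\<gamma> * y0 = \<beta> * z0" using t by (simp add: \<Theta>_def)
    obtain k where k: "\<beta> = k * y0" "\<gamma> = k * z0"
    proof (cases "y0 = 0")
      case True
      then show ?thesis using that[of "\<gamma> / z0"] eq B(5) by simp
    next
      case False
      then show ?thesis using that[of "\<beta> / y0"] eq by (simp add: field_simps)
    qed
    then have "k \<noteq> 0" using * by auto
    have "g (t + s * (\<alpha> / k), y0 * s, z0 * s) = 0" for s
      using *(2)[of "s / k"] \<open>k \<noteq> 0\<close> by (simp add: k mult.commute)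
    then show "\<exists>\<alpha>. \<forall>s z. g2 (t + s * \<alpha>, s, z) = 0" unfolding g2_def by (intro exI[of _ "\<alpha> / k"]) simp
  qed
  then have "g (x, s * y0, s * z0) = 0" for x s
    using g0[of "(x, s, 0)"] unfolding g2_def by (simp add: mult.commute)
  then show ?thesis using B(5) by (intro exI conjI allI)
qed

section \<open>Lines and planes\<close>

definition line :: "'a::comm_ring_1 pt \<Rightarrow> 'a pt \<Rightarrow> 'a pt set" where
  "line p v = range (pt_at p v)"

definition plane :: "'a::comm_ring_1 pt \<Rightarrow> 'a pt \<Rightarrow> 'a pt \<Rightarrow> 'a pt set" where
  "plane p v w = {pt_at (pt_at p v s) w t | s t. True}"

definition indep :: "'a::comm_ring_1 pt \<Rightarrow> 'a pt \<Rightarrow> bool" where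
  "indep v w \<longleftrightarrow> (\<forall>s t. pt_at (pt_at (0, 0, 0) v s) w t = (0, 0, 0) \<longrightarrow> s = 0 \<and> t = 0)"

definition lines :: "'a::comm_ring_1 pt set set" where
  "lines = {line p v | p v. v \<noteq> (0, 0, 0)}"

lemma pt_at_0 [simp]: "pt_at p v 0 = p"
  by (cases p; cases v) simp

lemma pt_at_add: "pt_at (pt_at p v s) v t = pt_at p v (s + t)"
  by (cases p; cases v) (simp add: algebra_simps)

lemma inj_pt_at:
  assumes "v \<noteq> (0, 0, 0 :: 'a::idom)"
  shows "inj (pt_at p v)"
  using assms by (cases p; cases v) (auto intro!: injI)

lemma line_rebase:
  assumes "x \<in> line p v"
  shows "line p v = line x v"
proof -
  obtain t where x: "x = pt_at p v t" using assms by (auto simp: line_def)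
  have "range (pt_at p v) = range (\<lambda>s. pt_at p v (t + s))"
    using surj_plus[of t] by (metis image_image)
  then show ?thesis by (simp add: line_def x pt_at_add)
qed

lemma lines_through:
  assumes "l \<in> lines" "x \<in> l"
  obtains v where "v \<noteq> (0, 0, 0)" "l = line x v"
  using assms line_rebase unfolding lines_def by blast

lemma line_eq_if_parallel:
  fixes d1 d2 :: "'a::field pt"
  assumes "d2 \<noteq> (0, 0, 0)" "\<And>s. pt_at x d2 s = pt_at x d1 (s * k)"
  shows "line x d2 = line x d1"
proof -
  have "k \<noteq> 0"
  proof
    assume "k = 0"
    then have "pt_at x d2 1 = pt_at x d2 0" using assms(2) by simp
    then show False using injD[OF inj_pt_at[OF assms(1)], of x 1 0] by simp
  qed
  then have "pt_at x d1 s = pt_at x d2 (s / k)" for s using assms(2)[of "s / k"] by simp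
  then have "range (pt_at x d1) \<subseteq> range (pt_at x d2)" by (metis image_subsetI rangeI)
  moreover have "range (pt_at x d2) \<subseteq> range (pt_at x d1)" using assms(2) by (metis image_subsetI rangeI)
  ultimately show ?thesis by (simp add: line_def)
qed

text \<open>\<open>v\<close> is completed to a basis by two unit vectors, chosen by a nonzero
  coordinate of \<open>v\<close>. Both directions must be affine: \<open>A\<close> carries
  \<open>f\<close> to the axis picture, \<open>B\<close> carries the quotient back.\<close>

lemma affine_frame:
  fixes v :: "'a::field pt"
  assumes "v \<noteq> (0, 0, 0)"
  obtains A B where "affmap A" "affmap B" "\<And>x. A (B x) = x" "\<And>x. B (A x) = x"
    "\<And>t. A (t, 0, 0) = pt_at p v t"
proof -
  obtain a b c where p: "p = (a, b, c)" by (cases p)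
  obtain v1 v2 v3 where v: "v = (v1, v2, v3)" by (cases v)
  consider "v1 \<noteq> 0" | "v2 \<noteq> 0" | "v3 \<noteq> 0" using assms v by auto
  then show ?thesis
  proof cases
    case 1
    define A where "A = (\<lambda>(x, y, z). (a + x * v1, b + x * v2 + y, c + x * v3 + z))"
    define B where "B = (\<lambda>(x, y, z). ((x - a) / v1, y - b - (x - a) / v1 * v2, z - c - (x - a) / v1 * v3))"
    show ?thesis
    proof (rule that)
      show "affmap A" by (rule affmapI[of _ a v1 0 0 b v2 1 0 c v3 0 1]) (simp add: A_def)
      show "affmap B" by (rule affmapI[of _ "-a/v1" "1/v1" 0 0 "-b+a/v1*v2" "-v2/v1" 1 0 "-c+a/v1*v3" "-v3/v1" 0 1])
        (simp add: B_def diff_divide_distrib algebra_simps)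
    qed (use 1 in \<open>auto simp: A_def B_def p v\<close>)
  next
    case 2
    define A where "A = (\<lambda>(x, y, z). (a + x * v1 + y, b + x * v2, c + x * v3 + z))"
    define B where "B = (\<lambda>(x, y, z). ((y - b) / v2, x - a - (y - b) / v2 * v1, z - c - (y - b) / v2 * v3))"
    show ?thesis
    proof (rule that)
      show "affmap A" by (rule affmapI[of _ a v1 1 0 b v2 0 0 c v3 0 1]) (simp add: A_def)
      show "affmap B" by (rule affmapI[of _ "-b/v2" 0 "1/v2" 0 "-a+b/v2*v1" 1 "-v1/v2" 0 "-c+b/v2*v3" 0 "-v3/v2" 1])
        (simp add: B_def diff_divide_distrib algebra_simps)
    qed (use 2 in \<open>auto simp: A_def B_def p v\<close>)
  next
    case 3
    define A where "A = (\<lambda>(x, y, z). (a + x * v1 + y, b + x * v2 + z, c + x * v3))"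
    define B where "B = (\<lambda>(x, y, z). ((z - c) / v3, x - a - (z - c) / v3 * v1, y - b - (z - c) / v3 * v2))"
    show ?thesis
    proof (rule that)
      show "affmap A" by (rule affmapI[of _ a v1 1 0 b v2 0 1 c v3 0 0]) (simp add: A_def)
      show "affmap B" by (rule affmapI[of _ "-c/v3" 0 0 "1/v3" "-a+c/v3*v1" 1 0 "-v1/v3" "-b+c/v3*v2" 0 1 "-v2/v3"])
        (simp add: B_def diff_divide_distrib algebra_simps)
    qed (use 3 in \<open>auto simp: A_def B_def p v\<close>)
  qed
qed

lemma two_elements_avoiding:
  assumes "3 \<le> card M" "l \<in> M"
  obtains m1 m2 where "m1 \<in> M" "m2 \<in> M" "m1 \<noteq> m2" "m1 \<noteq> l" "m2 \<noteq> l"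
proof -
  have fin: "finite M" using assms(1) by (metis card.infinite not_numeral_le_zero)
  have "2 \<le> card (M - {l})" using assms fin by (simp add: card_Diff_singleton)
  then have "M - {l} \<noteq> {}" by (metis card.empty not_numeral_le_zero)
  then obtain m1 where m1: "m1 \<in> M - {l}" by blast
  have "1 \<le> card (M - {l} - {m1})" using \<open>2 \<le> _\<close> m1 fin by (simp add: card_Diff_singleton)
  then have "M - {l} - {m1} \<noteq> {}" by (metis card.empty not_one_le_zero)
  then obtain m2 where "m2 \<in> M - {l} - {m1}" by blast
  then show ?thesis using m1 that by blast
qed

text \<open>The preceding result freed from coordinates, together with the division by the equation
  of the plane. Of that equation \<open>\<phi>\<close> only two properties are passed on: its zero
  set and that it is affine along every line.\<close>

lemma plane_divides_rich_line:
  fixes f :: "'a::{field,finite} pt \<Rightarrow> 'a"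
  assumes f: "poly3 n f" and n: "6 * n < CARD('a)" and char: "CHAR('a) = CARD('a)"
    and S: "S \<subseteq> lines" "\<And>m x. m \<in> S \<Longrightarrow> x \<in> m \<Longrightarrow> f x = 0"
    and l: "l \<in> S" and rich: "CARD('a) < 2 * card {x \<in> l. 3 \<le> card {m \<in> S. x \<in> m}}"
    and reg: "x0 \<in> l" "degree r0 \<le> n" "\<forall>s. poly r0 s = f (pt_at x0 d0 s)" "coeff r0 1 \<noteq> 0"
  shows "\<exists>p v w h \<phi>. indep v w \<and> l \<subseteq> plane p v w \<and> poly3 (n - 1) h \<and> (\<forall>x. f x = \<phi> x * h x) \<and>
    (\<forall>x. x \<in> plane p v w \<longleftrightarrow> \<phi> x = 0) \<and> (\<forall>x d. \<exists>b. \<forall>s. \<phi> (pt_at x d s) = \<phi> x + s * b)"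
proof -
  obtain v where v: "v \<noteq> (0, 0, 0)" "l = line x0 v" using lines_through S(1) l reg(1) by blast
  obtain A B where AB: "affmap A" "affmap B" "\<And>x. A (B x) = x" "\<And>x. B (A x) = x"
    "\<And>t. A (t, 0, 0) = pt_at x0 v t"
    using affine_frame[OF v(1)] by metis
  define g where "g = (\<lambda>p. f (A p))"
  have g: "poly3 n g" unfolding g_def by (rule poly3_affmap[OF f AB(1)])
  have axis_in: "A (t, 0, 0) \<in> l" for t by (simp add: AB(5) v(2) line_def)
  define T where "T = {t. 3 \<le> card {m \<in> S. A (t, 0, 0) \<in> m}}"
  have "{x \<in> l. 3 \<le> card {m \<in> S. x \<in> m}} \<subseteq> (\<lambda>t. A (t, 0, 0)) ` T"
    by (auto simp: T_def v(2) line_def AB(5))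
  then have "card {x \<in> l. 3 \<le> card {m \<in> S. x \<in> m}} \<le> card T"
    by (rule surj_card_le[OF finite])
  then have T: "CARD('a) < 2 * card T" using rich by linarith
  have B_pt: "B (pt_at (A (t, 0, 0)) d s) = (t + s * fst (linpart B d), s * fst (snd (linpart B d)), s * snd (snd (linpart B d)))"
    for t d s
    by (subst affmap_pt_at[OF AB(2)], cases "linpart B d") (simp add: AB(4))
  have "\<exists>y0 z0. (y0, z0) \<noteq> (0, 0) \<and> (\<forall>x s. g (x, s * y0, s * z0) = 0)"
  proof (rule flat_axis_in_plane[OF g n char])
    show "g (x, 0, 0) = 0" for x unfolding g_def by (rule S(2)[OF l axis_in])
    show "degree r0 \<le> n" "coeff r0 1 \<noteq> 0" by fact+
    have x0: "x0 = A (0, 0, 0)" by (simp add: AB(5))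
    show "poly r0 s = g (0 + s * fst (linpart B d0), s * fst (snd (linpart B d0)), s * snd (snd (linpart B d0)))" for s
      unfolding g_def B_pt[symmetric] AB(3) x0[symmetric] by (rule spec[OF reg(3)])
    show "CARD('a) < 2 * card T" by (rule T)
    fix t assume "t \<in> T"
    define x where "x = A (t, 0, 0)"
    have "3 \<le> card {m \<in> S. x \<in> m}" using \<open>t \<in> T\<close> by (simp add: T_def x_def)
    moreover have "l \<in> {m \<in> S. x \<in> m}" using l axis_in by (simp add: x_def)
    \<comment> \<open>The two lines other than \<open>l\<close> give the transversal, non-parallel
      directions required at a flat point.\<close>
    ultimately obtain m1 m2 where m: "m1 \<in> S" "x \<in> m1" "m2 \<in> S" "x \<in> m2" "m1 \<noteq> m2" "m1 \<noteq> l" "m2 \<noteq> l"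
      by (rule two_elements_avoiding) blast
    obtain d1 where d1: "d1 \<noteq> (0, 0, 0)" "m1 = line x d1" using lines_through S(1) m(1,2) by blast
    obtain d2 where d2: "d2 \<noteq> (0, 0, 0)" "m2 = line x d2" using lines_through S(1) m(3,4) by blast
    have lx: "l = line x v" using axis_in[of t] line_rebase v(2) by (metis x_def)
    obtain \<alpha>1 \<beta>1 \<gamma>1 where D1: "linpart B d1 = (\<alpha>1, \<beta>1, \<gamma>1)" by (cases "linpart B d1")
    obtain \<alpha>2 \<beta>2 \<gamma>2 where D2: "linpart B d2 = (\<alpha>2, \<beta>2, \<gamma>2)" by (cases "linpart B d2")
    have B1: "B (pt_at x d1 s) = (t + s * \<alpha>1, s * \<beta>1, s * \<gamma>1)" for s
      using B_pt[of t d1 s] by (simp add: D1 x_def)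
    have B2: "B (pt_at x d2 s) = (t + s * \<alpha>2, s * \<beta>2, s * \<gamma>2)" for s
      using B_pt[of t d2 s] by (simp add: D2 x_def)
    have nz: "(\<beta>, \<gamma>) \<noteq> (0, 0)" if "d \<noteq> (0, 0, 0)" "line x d \<noteq> l" "\<And>s. B (pt_at x d s) = (t + s * \<alpha>, s * \<beta>, s * \<gamma>)" for \<alpha> \<beta> \<gamma> d
    proof
      assume 0: "(\<beta>, \<gamma>) = (0, 0)"
      have "pt_at x d s = pt_at x v (s * \<alpha>)" for s
      proof -
        have "pt_at x d s = A (B (pt_at x d s))" by (simp add: AB(3))
        also have "\<dots> = A (t + s * \<alpha>, 0, 0)" using 0 by (simp add: that(3))
        also have "\<dots> = pt_at x v (s * \<alpha>)" by (simp add: AB(5) x_def pt_at_add)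
        finally show ?thesis .
      qed
      from line_eq_if_parallel[OF that(1) this] that(2) lx show False by simp
    qed
    have "(\<alpha>2, \<beta>2, \<gamma>2) \<noteq> (k * \<alpha>1, k * \<beta>1, k * \<gamma>1)" for k
    proof
      assume k: "(\<alpha>2, \<beta>2, \<gamma>2) = (k * \<alpha>1, k * \<beta>1, k * \<gamma>1)"
      have "pt_at x d2 s = pt_at x d1 (s * k)" for s
      proof -
        have "B (pt_at x d2 s) = B (pt_at x d1 (s * k))" using k by (simp add: B1 B2)
        then show ?thesis by (metis AB(3))
      qed
      from line_eq_if_parallel[OF d2(1) this] m(5) d1 d2 show False by simp
    qed
    moreover have "g (t + s * \<alpha>1, s * \<beta>1, s * \<gamma>1) = 0" for s
      unfolding g_def B1[symmetric] AB(3) by (rule S(2)[OF m(1)]) (simp add: d1 line_def)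
    moreover have "g (t + s * \<alpha>2, s * \<beta>2, s * \<gamma>2) = 0" for s
      unfolding g_def B2[symmetric] AB(3) by (rule S(2)[OF m(3)]) (simp add: d2 line_def)
    moreover have "(\<beta>1, \<gamma>1) \<noteq> (0, 0)" by (rule nz[OF d1(1) _ B1]) (use m d1 in simp)
    moreover have "(\<beta>2, \<gamma>2) \<noteq> (0, 0)" by (rule nz[OF d2(1) _ B2]) (use m d2 in simp)
    ultimately show "\<exists>\<alpha>1 \<beta>1 \<gamma>1 \<alpha>2 \<beta>2 \<gamma>2. (\<beta>1, \<gamma>1) \<noteq> (0, 0) \<and> (\<beta>2, \<gamma>2) \<noteq> (0, 0) \<and>
        (\<forall>k. (\<alpha>2, \<beta>2, \<gamma>2) \<noteq> (k * \<alpha>1, k * \<beta>1, k * \<gamma>1)) \<and>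
        (\<forall>s. g (t + s * \<alpha>1, s * \<beta>1, s * \<gamma>1) = 0) \<and> (\<forall>s. g (t + s * \<alpha>2, s * \<beta>2, s * \<gamma>2) = 0)"
      by (intro exI conjI allI)
  qed
  then obtain y0 z0 where yz: "(y0, z0) \<noteq> (0, 0)" "\<And>x s. g (x, s * y0, s * z0) = 0" by blast
  \<comment> \<open>A vector on which the linear part of \<open>\<psi>\<close> is 1, so that the
    shift in \<open>poly3_div_aff\<close> projects onto the plane and the remainder is zero.\<close>
  obtain u2 u3 where u: "z0 * u2 - y0 * u3 = 1"
  proof (cases "z0 = 0")
    case True
    then show ?thesis using that[of 0 "- 1 / y0"] yz(1) by simp
  next
    case False
    then show ?thesis using that[of "1 / z0" 0] by simp
  qed
  define \<psi> where "\<psi> = aff 0 0 z0 (- y0)"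
  have \<psi>_zero: "\<psi> (x, y, z) = 0 \<longleftrightarrow> (\<exists>s. y = s * y0 \<and> z = s * z0)" for x y z
  proof
    assume "\<psi> (x, y, z) = 0"
    then have eq: "z0 * y = y0 * z" by (simp add: \<psi>_def)
    show "\<exists>s. y = s * y0 \<and> z = s * z0"
    proof (cases "z0 = 0")
      case True
      then show ?thesis using eq yz(1) by (intro exI[of _ "y / y0"]) simp
    next
      case False
      then show ?thesis using eq by (intro exI[of _ "z / z0"]) (simp add: nonzero_eq_divide_eq mult.commute)
    qed
  qed (auto simp: \<psi>_def)
  obtain h where h: "poly3 (n - 1) h" and gh: "\<forall>p. g p = g (pt_at p (0, u2, u3) (- \<psi> p)) + \<psi> p * h p"
    using poly3_div_aff[OF g, of \<psi> 0 0 z0 "- y0" "(0, u2, u3)"] unfolding \<psi>_def by blast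
  have gh': "g p = \<psi> p * h p" for p
  proof -
    obtain x y z where p: "p = (x, y, z)" by (cases p)
    have "\<psi> (x, y - \<psi> p * u2, z - \<psi> p * u3) = \<psi> p - \<psi> p * (z0 * u2 - y0 * u3)"
      by (simp add: \<psi>_def p algebra_simps)
    then have "\<psi> (x, y - \<psi> p * u2, z - \<psi> p * u3) = 0" by (simp add: u)
    then obtain s where "y - \<psi> p * u2 = s * y0" "z - \<psi> p * u3 = s * z0" using \<psi>_zero by blast
    then have "g (pt_at p (0, u2, u3) (- \<psi> p)) = 0" using yz(2) by (simp add: p)
    then show ?thesis using spec[OF gh, of p] by simp
  qed
  define p where "p = A (0, 0, 0)"
  define v' where "v' = linpart A (1, 0, 0)"
  define w where "w = linpart A (0, y0, z0)"
  have A_pl: "pt_at (pt_at p v' s) w t = A (s, t * y0, t * z0)" for s t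
    unfolding p_def v'_def w_def affmap_pt_at[OF AB(1), symmetric] by simp
  show ?thesis
  proof (rule exI[of _ p], rule exI[of _ v'], rule exI[of _ w], rule exI[of _ "\<lambda>x. h (B x)"],
      rule exI[of _ "\<lambda>x. \<psi> (B x)"], intro conjI allI)
    show "indep v' w" unfolding indep_def
    proof (intro allI impI)
      fix s t assume "pt_at (pt_at (0, 0, 0) v' s) w t = (0, 0, 0)"
      then have "pt_at (pt_at p v' s) w t = p"
        by (cases p; cases v'; cases w) (simp add: add.assoc)
      then have "B (A (s, t * y0, t * z0)) = B (A (0, 0, 0))" unfolding A_pl by (simp add: p_def)
      then show "s = 0 \<and> t = 0" using yz(1) by (auto simp: AB(4))
    qed
    have pl: "x \<in> plane p v' w \<longleftrightarrow> \<psi> (B x) = 0" for x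
    proof -
      obtain a b c where abc: "B x = (a, b, c)" by (cases "B x")
      have "x \<in> plane p v' w \<longleftrightarrow> (\<exists>s t. x = A (s, t * y0, t * z0))"
        unfolding plane_def A_pl by blast
      also have "\<dots> \<longleftrightarrow> (\<exists>s t. B x = (s, t * y0, t * z0))" by (metis AB(3) AB(4))
      also have "\<dots> \<longleftrightarrow> \<psi> (B x) = 0" by (simp add: abc \<psi>_zero)
      finally show ?thesis .
    qed
    then show "x \<in> plane p v' w \<longleftrightarrow> \<psi> (B x) = 0" for x .
    show "l \<subseteq> plane p v' w"
    proof
      fix x assume "x \<in> l"
      then obtain t where "x = A (t, 0, 0)" by (auto simp: v(2) line_def AB(5))
      then show "x \<in> plane p v' w" by (simp add: pl AB(4) \<psi>_def)
    qed
    show "poly3 (n - 1) (\<lambda>x. h (B x))" by (rule poly3_affmap[OF h AB(2)])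
    show "f x = \<psi> (B x) * h (B x)" for x using gh'[of "B x"] by (simp add: g_def AB(3))
    show "\<exists>b. \<forall>s. \<psi> (B (pt_at x d s)) = \<psi> (B x) + s * b" for x d
      unfolding affmap_pt_at[OF AB(2)]
      by (cases "B x"; cases "linpart B d") (auto simp: \<psi>_def algebra_simps 
         intro!: exI[of _ "z0 * fst (snd (linpart B d)) - y0 * snd (snd (linpart B d))"])
  qed
qed

section \<open>Counting lines on a surface of low degree\<close>

lemma card_line:
  fixes l :: "'a::{field,finite} pt set"
  assumes "l \<in> lines"
  shows "card l = CARD('a)"
proof -
  obtain p v where "v \<noteq> (0, 0, 0)" "l = range (pt_at p v)"
    using assms unfolding lines_def line_def by blast
  then show ?thesis using card_image[OF inj_pt_at] by metis
qed

text \<open>Pointwise division fails where \<open>m\<close> meets the plane. As polynomials on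
  \<open>m\<close>, the nonzero linear restriction of \<open>\<phi>\<close> times that of
  \<open>h\<close> has degree below q and vanishes everywhere, so the restriction of
  \<open>h\<close> is the zero polynomial.\<close>

lemma vanishes_on_line_off_plane:
  fixes h :: "'a::{field,finite} pt \<Rightarrow> 'a"
  assumes h: "poly3 (n - 1) h" and n: "0 < n" "n < CARD('a)"
    and m: "m \<in> lines" "y \<in> m" "\<phi> y \<noteq> 0" "\<And>x. x \<in> m \<Longrightarrow> \<phi> x * h x = 0"
    and \<phi>: "\<forall>x d. \<exists>b. \<forall>s. \<phi> (pt_at x d s) = \<phi> x + s * b"
    and x: "x \<in> m"
  shows "h x = 0"
proof -
  obtain d where d: "m = line y d" using lines_through m(1,2) by metis
  obtain r where r: "degree r \<le> n - 1" "\<And>s. poly r s = h (pt_at y d s)"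
    using poly3_line[OF h] by metis
  obtain b where b: "\<And>s. \<phi> (pt_at y d s) = \<phi> y + s * b" using \<phi> by metis
  have "degree ([:\<phi> y, b:] * r) \<le> Suc (n - 1)" using r(1) by (rule degree_linear_mult)
  then have "degree ([:\<phi> y, b:] * r) < CARD('a)" using n by linarith
  moreover have "poly ([:\<phi> y, b:] * r) s = 0" for s
  proof -
    have "(\<phi> y + s * b) * h (pt_at y d s) = 0"
      unfolding b[symmetric] by (rule m(4)) (simp add: d line_def)
    moreover have "poly [:\<phi> y, b:] s = \<phi> y + s * b" by simp
    ultimately show ?thesis by (simp only: poly_mult r(2))
  qed
  ultimately have "[:\<phi> y, b:] * r = 0" by (intro poly_eqI_degree[of UNIV]) auto
  moreover have "[:\<phi> y, b:] \<noteq> 0" using m(3) by simp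
  ultimately have "r = 0" using mult_eq_0_iff by blast
  moreover obtain s where "x = pt_at y d s" using x by (auto simp: d line_def)
  ultimately show ?thesis using r(2)[of s] by simp
qed

text \<open>The characteristic must exceed the degree: otherwise all derivatives may vanish.\<close>

lemma minimal_degree_regular_point:
  fixes f :: "'a::{field,finite} pt \<Rightarrow> 'a"
  assumes f: "poly3 n f" "f y \<noteq> 0" and n: "n < CARD('a)" and char: "CHAR('a) = CARD('a)"
    and Z: "\<And>x. x \<in> Z \<Longrightarrow> f x = 0" "Z \<noteq> {}"
    and min: "\<forall>g. n \<noteq> 0 \<longrightarrow> poly3 (n - 1) g \<longrightarrow> (\<forall>x\<in>Z. g x = 0) \<longrightarrow> (\<forall>x. g x = 0)"
  shows "\<exists>x d r. x \<in> Z \<and> degree r \<le> n \<and> (\<forall>s. poly r s = f (pt_at x d s)) \<and> coeff r 1 \<noteq> 0"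
proof (rule ccontr)
  assume "\<not> ?thesis"
  then have crit: "coeff r 1 = 0" if "x \<in> Z" "degree r \<le> n" "\<forall>s. poly r s = f (pt_at x d s)" for x d r
    using that by blast
  obtain f1 f2 f3 where p: "poly3 (n - 1) f1" "poly3 (n - 1) f2" "poly3 (n - 1) f3"
    and z: "n = 0 \<longrightarrow> (\<forall>p. f1 p = 0 \<and> f2 p = 0 \<and> f3 p = 0)"
    and ex: "\<And>p v. \<exists>r. degree r \<le> n \<and> (\<forall>s. poly r s = f (pt_at p v s)) \<and>
      (\<forall>s. poly (pderiv r) s = fst v * f1 (pt_at p v s) + fst (snd v) * f2 (pt_at p v s)
                             + snd (snd v) * f3 (pt_at p v s))"
    using poly3_derivs[OF f(1)] by blast
  have on_Z: "fst v * f1 x + fst (snd v) * f2 x + snd (snd v) * f3 x = 0" if x: "x \<in> Z" for x v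
  proof -
    obtain r where r: "degree r \<le> n" "\<forall>s. poly r s = f (pt_at x v s)"
      "\<forall>s. poly (pderiv r) s = fst v * f1 (pt_at x v s) + fst (snd v) * f2 (pt_at x v s)
                             + snd (snd v) * f3 (pt_at x v s)" using ex by blast
    have "coeff r 1 = 0" by (rule crit[OF x r(1,2)])
    then have "poly (pderiv r) 0 = 0" by (simp add: poly_0_coeff_0 coeff_pderiv)
    then show ?thesis using r(3)[rule_format, of 0] by simp
  qed
  \<comment> \<open>Minimality is applied to the partial derivatives: they have lower degree and
    vanish on \<open>Z\<close>, hence everywhere.\<close>
  have vanish: "g x = 0" if "poly3 (n - 1) g" "n = 0 \<longrightarrow> (\<forall>x. g x = 0)" "\<And>x. x \<in> Z \<Longrightarrow> g x = 0" for g x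
    using min that by blast
  have fz: "f1 x = 0" "f2 x = 0" "f3 x = 0" for x
  proof -
    show "f1 x = 0" by (rule vanish[OF p(1)]) (use z on_Z[of _ "(1, 0, 0)"] in simp_all)
    show "f2 x = 0" by (rule vanish[OF p(2)]) (use z on_Z[of _ "(0, 1, 0)"] in simp_all)
    show "f3 x = 0" by (rule vanish[OF p(3)]) (use z on_Z[of _ "(0, 0, 1)"] in simp_all)
  qed
  obtain x where x: "x \<in> Z" using Z(2) by blast
  \<comment> \<open>The line from a zero \<open>x\<close> to the nonzero \<open>y\<close>: on it
    \<open>f\<close> would have derivative zero and so be constant.\<close>
  define v where "v = pt_at y x (- 1)"
  have y: "pt_at x v 1 = y" by (cases x; cases y) (simp add: v_def)
  obtain r where r: "degree r \<le> n" "\<forall>s. poly r s = f (pt_at x v s)" "\<forall>s. poly (pderiv r) s = 0"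
    using ex[of x v] fz by auto
  have "pderiv r = 0"
    by (rule poly_eqI_degree[of UNIV]) (use r n char in \<open>simp_all add: degree_pderiv_char\<close>)
  then have "degree r = 0" using r(1) n char by (intro pderiv_eq_0_char) auto
  then obtain c where "r = [:c:]" by (metis degree_eq_zeroE)
  then have "f (pt_at x v 0) = f (pt_at x v 1)" using r(2) by (metis poly_pCons poly_0 mult_zero_right)
  then show False using Z(1)[OF x] f(2) y by simp
qed

text \<open>Truncating the multiplicities at 2 makes the removal of a line with many points of multiplicity
  at most 2 pay for itself, while the total stays bounded by twice the number of points.\<close>

definition richness :: "'a pt set set \<Rightarrow> nat" where
  "richness S = (\<Sum>x\<in>UNIV. min 2 (card {m \<in> S. x \<in> m}))"

lemma richness_mono:
  fixes S :: "'a::finite pt set set"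
  assumes "S' \<subseteq> S"
  shows "richness S' \<le> richness S"
  unfolding richness_def
proof (rule sum_mono)
  fix x
  have "card {m \<in> S'. x \<in> m} \<le> card {m \<in> S. x \<in> m}" by (rule card_mono) (use assms in auto)
  then show "min 2 (card {m \<in> S'. x \<in> m}) \<le> min 2 (card {m \<in> S. x \<in> m})" by simp
qed

text \<open>At a point of \<open>l\<close> of multiplicity 1 or 2 the truncation is inactive, so its
  term drops by exactly one; no other term grows.\<close>

lemma richness_remove:
  fixes S :: "'a::finite pt set set"
  assumes "l \<in> S"
  shows "richness (S - {l}) + card {x \<in> l. card {m \<in> S. x \<in> m} \<le> 2} \<le> richness S"
proof -
  let ?b = "\<lambda>x. if x \<in> l \<and> card {m \<in> S. x \<in> m} \<le> 2 then 1 else 0 :: nat"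
  have "card {x \<in> l. card {m \<in> S. x \<in> m} \<le> 2} = (\<Sum>x\<in>UNIV. ?b x)"
    by (simp add: sum.If_cases Int_def)
  moreover have "min 2 (card {m \<in> S - {l}. x \<in> m}) + ?b x \<le> min 2 (card {m \<in> S. x \<in> m})" for x
  proof (cases "x \<in> l")
    case True
    have "{m \<in> S - {l}. x \<in> m} = {m \<in> S. x \<in> m} - {l}" by auto
    then have c: "card {m \<in> S - {l}. x \<in> m} = card {m \<in> S. x \<in> m} - 1"
      using True assms by (simp add: card_Diff_singleton)
    have "0 < card {m \<in> S. x \<in> m}" using True assms by (auto simp: card_gt_0_iff)
    then show ?thesis unfolding c by auto
  next
    case False
    have "{m \<in> S - {l}. x \<in> m} = {m \<in> S. x \<in> m}" using False by auto
    then show ?thesis using False by simp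
  qed
  ultimately show ?thesis unfolding richness_def
    by (simp add: sum_mono flip: sum.distrib)
qed

text \<open>The claim, multiplied by q, is an account. A removed line lowers \<open>richness\<close>
  by at least q / 2, with weight 2; a removed plane takes at most \<open>K\<close> lines and lowers
  the degree by one. The polynomial changes along with the lines, so \<open>n\<close>,
  \<open>f\<close>, \<open>y\<close> are generalized in the induction on
  \<open>card S\<close>.\<close>

lemma lines_in_zero_set_bound:
  fixes f :: "'a::{field,finite} pt \<Rightarrow> 'a" and K :: real
  assumes char: "CHAR('a) = CARD('a)" and K: "0 \<le> K"
    and "S \<subseteq> lines" "poly3 n f" "6 * n < CARD('a)" "f y \<noteq> 0"
    and "\<And>m x. m \<in> S \<Longrightarrow> x \<in> m \<Longrightarrow> f x = 0"
    and "\<And>p v w. indep v w \<Longrightarrow> card {m \<in> S. m \<subseteq> plane p v w} \<le> K"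
  shows "real (card S) * CARD('a) \<le> 2 * richness S + K * CARD('a) * n"
  using assms(3-)
proof (induction "card S" arbitrary: S n f y rule: less_induct)
  case less
  define q where "q = CARD('a)"
  show ?case
  proof (cases "S = {}")
    case True
    then show ?thesis using K by simp
  next
    case nonempty: False
    show ?thesis
    proof (cases "\<exists>l\<in>S. q \<le> 2 * card {x \<in> l. card {m \<in> S. x \<in> m} \<le> 2}")
      case True
      then obtain l where l: "l \<in> S" "q \<le> 2 * card {x \<in> l. card {m \<in> S. x \<in> m} \<le> 2}" by blast
      have c: "card (S - {l}) = card S - 1" "card S > 0" using l(1) by (auto simp: card_gt_0_iff)
      have "real (card (S - {l})) * CARD('a) \<le> 2 * richness (S - {l}) + K * CARD('a) * n"
      proof (rule less.hyps[of "S - {l}" n f y])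
        show "card {m \<in> S - {l}. m \<subseteq> plane p v w} \<le> K" if "indep v w" for p v w
        proof -
          have "card {m \<in> S - {l}. m \<subseteq> plane p v w} \<le> card {m \<in> S. m \<subseteq> plane p v w}"
            by (rule card_mono) auto
          then show ?thesis using less.prems(6)[OF that, of p] by linarith
        qed
      qed (use less.prems c in auto)
      moreover have "real (card S) = real (card (S - {l})) + 1" using c by simp
      moreover have "2 * richness (S - {l}) + q \<le> 2 * richness S"
        using richness_remove[OF l(1)] l(2) by linarith
      then have "2 * real (richness (S - {l})) + CARD('a) \<le> 2 * real (richness S)"
        unfolding q_def by linarith
      ultimately show ?thesis by (simp add: distrib_right)
    next
      case rich: False
      \<comment> \<open>The inherited \<open>f\<close> may be singular along all lines of
        \<open>S\<close>, for instance a square; hence a polynomial of least degree is chosen anew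
        for the current \<open>S\<close>.\<close>
      define Q where "Q = (\<lambda>n. \<exists>f :: 'a pt \<Rightarrow> 'a. \<exists>y. poly3 n f \<and> f y \<noteq> 0 \<and> (\<forall>m\<in>S. \<forall>x\<in>m. f x = 0))"
      define k where "k = (LEAST n. Q n)"
      have Q: "Q n" unfolding Q_def using less.prems(2,4,5) by blast
      obtain g z where g: "poly3 k g" "g z \<noteq> 0" "\<And>m x. m \<in> S \<Longrightarrow> x \<in> m \<Longrightarrow> g x = 0"
        using LeastI[of Q, OF Q] unfolding k_def[symmetric] unfolding Q_def by blast
      have kn: "k \<le> n" unfolding k_def by (rule Least_le[of Q, OF Q])
      have k: "6 * k < CARD('a)" using kn less.prems(3) by linarith
      obtain l0 where "l0 \<in> S" using nonempty by blast
      moreover have "l0 \<noteq> {}" using \<open>l0 \<in> S\<close> less.prems(1) by (auto simp: lines_def line_def)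
      ultimately have Un: "\<Union>S \<noteq> {}" by blast
      have "k \<noteq> 0"
      proof
        assume "k = 0"
        then obtain c where "\<forall>p. g p = c" using poly3_0_const[OF g(1)] by blast
        moreover obtain x where "x \<in> \<Union>S" using Un by blast
        ultimately show False using g(2,3) by (metis UnionE)
      qed
      have min: "h x = 0" if "poly3 (k - 1) h" "\<forall>x\<in>\<Union>S. h x = 0" for h x
      proof (rule ccontr)
        assume "h x \<noteq> 0"
        then have "Q (k - 1)" unfolding Q_def using that by blast
        then have "k \<le> k - 1" unfolding k_def by (rule Least_le)
        then show False using \<open>k \<noteq> 0\<close> by simp
      qed
      have kq: "k < CARD('a)" using k by linarith
      have zs: "g x = 0" if "x \<in> \<Union>S" for x using that g(3) by blast
      have min': "\<forall>h. k \<noteq> 0 \<longrightarrow> poly3 (k - 1) h \<longrightarrow> (\<forall>x\<in>\<Union>S. h x = 0) \<longrightarrow> (\<forall>x. h x = 0)"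
        using min by blast
      obtain x d r where x: "x \<in> \<Union>S" "degree r \<le> k" "\<forall>s. poly r s = g (pt_at x d s)" "coeff r 1 \<noteq> 0"
        using minimal_degree_regular_point[where f = g and y = z and Z = "\<Union>S", OF g(1,2) kq char zs Un min'] by blast
      obtain l where l: "l \<in> S" "x \<in> l" using x(1) by blast
      have rl: "CARD('a) < 2 * card {x \<in> l. 3 \<le> card {m \<in> S. x \<in> m}}"
      proof -
        let ?R = "{x \<in> l. 3 \<le> card {m \<in> S. x \<in> m}}" and ?P = "{x \<in> l. card {m \<in> S. x \<in> m} \<le> 2}"
        have "card l \<le> card (?R \<union> ?P)" by (rule card_mono) auto
        also have "\<dots> \<le> card ?R + card ?P" by (rule card_Un_le)
        finally have "card l \<le> card ?R + card ?P" .
        moreover have "card l = q" unfolding q_def by (rule card_line) (use l less.prems in auto)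
        moreover have "2 * card {x \<in> l. card {m \<in> S. x \<in> m} \<le> 2} < q" using rich l(1) by (meson not_le)
        ultimately show ?thesis unfolding q_def by linarith
      qed
      have "\<exists>p v w h \<phi>. indep v w \<and> l \<subseteq> plane p v w \<and> poly3 (k - 1) h \<and> (\<forall>x. g x = \<phi> x * h x) \<and>
          (\<forall>x. x \<in> plane p v w \<longleftrightarrow> \<phi> x = 0) \<and> (\<forall>x d. \<exists>b. \<forall>s. \<phi> (pt_at x d s) = \<phi> x + s * b)"
        by (rule plane_divides_rich_line[OF g(1) k char less.prems(1) _ l(1) rl l(2) x(2,3,4)]) (rule g(3))
      then obtain p v w h \<phi> where pl: "indep v w" "l \<subseteq> plane p v w" "poly3 (k - 1) h" "\<forall>x. g x = \<phi> x * h x"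
        "\<forall>x. x \<in> plane p v w \<longleftrightarrow> \<phi> x = 0" "\<forall>x d. \<exists>b. \<forall>s. \<phi> (pt_at x d s) = \<phi> x + s * b" by blast
      \<comment> \<open>Lines in the plane are charged to the lost degree; on all others the
        quotient \<open>h\<close> still vanishes, so the induction continues with them.\<close>
      define S1 where "S1 = {m \<in> S. m \<subseteq> plane p v w}"
      define S2 where "S2 = {m \<in> S. \<not> m \<subseteq> plane p v w}"
      have S: "S = S1 \<union> S2" "S1 \<inter> S2 = {}" by (auto simp: S1_def S2_def)
      have "real (card S2) * CARD('a) \<le> 2 * richness S2 + K * CARD('a) * (k - 1 :: nat)"
      proof (rule less.hyps[OF _ _ pl(3)])
        show "card S2 < card S" by (rule psubset_card_mono) (use l(1) pl(2) in \<open>auto simp: S2_def\<close>)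
        show "S2 \<subseteq> lines" using less.prems(1) by (auto simp: S2_def)
        show "6 * (k - 1) < CARD('a)" using k by linarith
        show "h z \<noteq> 0" using g(2) spec[OF pl(4), of z] by auto
        show "h x = 0" if m: "m \<in> S2" and xm: "x \<in> m" for m x
        proof -
          have "\<not> m \<subseteq> plane p v w" using m by (simp add: S2_def)
          then obtain y where "y \<in> m" "y \<notin> plane p v w" by blast
          then have y: "y \<in> m" "\<phi> y \<noteq> 0" using pl(5) by blast+
          show ?thesis
          proof (rule vanishes_on_line_off_plane[OF pl(3) _ _ _ y _ pl(6) xm])
            show "m \<in> lines" using m less.prems(1) by (auto simp: S2_def)
            show "\<phi> x * h x = 0" if "x \<in> m" for x
              using g(3)[of m x] m that spec[OF pl(4), of x] by (simp add: S2_def)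
          qed (use \<open>k \<noteq> 0\<close> k in linarith)+
        qed
        show "card {m \<in> S2. m \<subseteq> plane p v w} \<le> K" if "indep v w" for p v w
        proof -
          have "card {m \<in> S2. m \<subseteq> plane p v w} \<le> card {m \<in> S. m \<subseteq> plane p v w}"
            by (rule card_mono) (auto simp: S2_def)
          then show ?thesis using less.prems(6)[OF that, of p] by linarith
        qed
      qed
      moreover have "real (card S) = real (card S1) + real (card S2)"
        unfolding S(1) by (subst card_Un_disjoint) (use S(2) in auto)
      then have "real (card S) * CARD('a) = real (card S1) * CARD('a) + real (card S2) * CARD('a)"
        by (simp add: distrib_right)
      moreover have "real (card S1) * CARD('a) \<le> K * CARD('a)"
        using less.prems(6)[OF pl(1), of p] by (intro mult_right_mono) (auto simp: S1_def)
      moreover have "real (richness S2) \<le> real (richness S)" using richness_mono[of S2 S] S(1) by simp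
      moreover have "K * CARD('a) * (k - 1 :: nat) + K * CARD('a) = K * CARD('a) * k"
        using \<open>k \<noteq> 0\<close> by (cases k) (simp_all add: algebra_simps)
      moreover have "K * CARD('a) * k \<le> K * CARD('a) * n"
        using kn K by (intro mult_left_mono) auto
      ultimately show ?thesis by linarith
    qed
  qed
qed

lemma richness_le:
  fixes S :: "'a::finite pt set set"
  assumes "\<And>m. m \<in> S \<Longrightarrow> m \<subseteq> P"
  shows "richness S \<le> 2 * card P"
proof -
  have "richness S = (\<Sum>x\<in>P. min 2 (card {m \<in> S. x \<in> m}))"
    unfolding richness_def
  proof (rule sum.mono_neutral_right)
    show "\<forall>x\<in>UNIV - P. min 2 (card {m \<in> S. x \<in> m}) = 0"
    proof
      fix x assume "x \<in> UNIV - P"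
      then have "{m \<in> S. x \<in> m} = {}" using assms by auto
      then show "min 2 (card {m \<in> S. x \<in> m}) = 0" by (metis card.empty min_0R)
    qed
  qed auto
  also have "\<dots> \<le> (\<Sum>x\<in>P. 2)" by (rule sum_mono) simp
  finally show ?thesis by simp
qed

section \<open>Interpolation\<close>

lemma poly3_sum:
  "(\<And>i. i \<in> I \<Longrightarrow> poly3 n (f i)) \<Longrightarrow> poly3 n (\<lambda>p. \<Sum>i\<in>I. f i p)"
  by (induction I rule: infinite_finite_induct) (auto intro: poly3.intros)

lemma poly3_aff_power_mult:
  assumes "poly3 n f"
  shows "poly3 (n + i) (\<lambda>p. aff c0 c1 c2 c3 p ^ i * f p)"
  by (induction i) (auto simp: mult.assoc assms intro: poly3_aff_mult)

lemma poly3_monomial: "poly3 (i + j + k) (\<lambda>(x, y, z). c * z ^ k * y ^ j * x ^ i)"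
proof -
  have "poly3 (0 + k + j + i) (\<lambda>p. aff 0 1 0 0 p ^ i * (aff 0 0 1 0 p ^ j * (aff 0 0 0 1 p ^ k * c)))"
    by (intro poly3_aff_power_mult poly3_const)
  also have "(\<lambda>p. aff 0 1 0 0 p ^ i * (aff 0 0 1 0 p ^ j * (aff 0 0 0 1 p ^ k * c)))
     = (\<lambda>(x, y, z). c * z ^ k * y ^ j * x ^ i)"
    by (auto simp: mult_ac)
  finally show ?thesis by (simp add: ac_simps)
qed

lemma power_sum_eq_0_coeffs:
  fixes a :: "nat \<Rightarrow> 'a::{field,finite}"
  assumes "\<And>x. (\<Sum>i<m. a i * x ^ i) = 0" "m \<le> CARD('a)" "i < m"
  shows "a i = 0"
proof -
  define p where "p = (\<Sum>i<m. monom (a i) i)"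
  have "degree p < CARD('a)"
    unfolding p_def using assms(2,3) by (intro degree_sum_less le_less_trans[OF degree_monom_le]) auto
  moreover have "poly p x = 0" for x using assms(1) by (simp add: p_def poly_sum poly_monom)
  ultimately have "p = 0" by (intro poly_eqI_degree[of UNIV]) auto
  moreover have "coeff p i = a i" using assms(3) by (simp add: p_def coeff_sum)
  ultimately show ?thesis by simp
qed

text \<open>Counting replaces linear algebra: there are q^(m^3) coefficient families but only q^|P|
  value patterns on \<open>P\<close>, so two families agree on \<open>P\<close> and their difference
  vanishes there. It is nonzero as a function since its degree in each variable is below m, which is
  at most q.\<close>

lemma exists_poly3_vanishing:
  fixes P :: "'a::{field,finite} pt set"
  assumes "card P < m ^ 3" "m \<le> CARD('a)"
  shows "\<exists>f y. poly3 (3 * (m - 1)) f \<and> f y \<noteq> 0 \<and> (\<forall>x\<in>P. f x = 0)"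
proof -
  define ev :: "(nat \<times> nat \<times> nat \<Rightarrow> 'a) \<Rightarrow> 'a pt \<Rightarrow> 'a" where
    "ev = (\<lambda>c (x, y, z). \<Sum>i<m. (\<Sum>j<m. (\<Sum>k<m. c (i, j, k) * z ^ k) * y ^ j) * x ^ i)"
  have ev_diff: "ev (\<lambda>i. c i - d i) x = ev c x - ev d x" for c d x
    by (cases x) (simp add: ev_def left_diff_distrib sum_subtractf)
  have ev_poly: "poly3 (3 * (m - 1)) (ev c)" for c
  proof -
    have eq: "ev c = (\<lambda>p. \<Sum>i<m. \<Sum>j<m. \<Sum>k<m. (\<lambda>(x, y, z). c (i, j, k) * z ^ k * y ^ j * x ^ i) p)"
      by (auto simp: ev_def sum_distrib_right)
    show ?thesis unfolding eq
      by (intro poly3_sum poly3_mono[OF poly3_monomial]) auto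
  qed
  let ?I = "{..<m} \<times> {..<m} \<times> {..<m}"
  let ?C = "?I \<rightarrow>\<^sub>E (UNIV :: 'a set)"
  have I: "card ?I = m ^ 3" by (simp add: card_cartesian_product power3_eq_cube)
  have "1 < CARD('a)" using card_mono[of "UNIV :: 'a set" "{0, 1}"] by simp
  then have "CARD('a) ^ card P < CARD('a) ^ card ?I"
    unfolding I using assms(1) by (rule power_strict_increasing[rotated])
  then have "card (P \<rightarrow>\<^sub>E (UNIV :: 'a set)) < card ?C"
    by (simp add: card_PiE del: card_cartesian_product)
  moreover have "(\<lambda>c. restrict (ev c) P) ` ?C \<subseteq> P \<rightarrow>\<^sub>E (UNIV :: 'a set)" by auto
  ultimately have "\<not> inj_on (\<lambda>c. restrict (ev c) P) ?C"
    using card_inj_on_le[of "\<lambda>c. restrict (ev c) P" ?C "P \<rightarrow>\<^sub>E (UNIV :: 'a set)"]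
    by (auto simp: finite_PiE)
  then obtain c d where cd: "c \<in> ?C" "d \<in> ?C" "c \<noteq> d" "restrict (ev c) P = restrict (ev d) P"
    unfolding inj_on_def by blast
  define f where "f = ev (\<lambda>i. c i - d i)"
  have "f x = 0" if "x \<in> P" for x
    using fun_cong[OF cd(4), of x] that by (simp add: f_def ev_diff)
  moreover have "\<exists>y. f y \<noteq> 0"
  proof (rule ccontr)
    assume "\<nexists>y. f y \<noteq> 0"
    \<comment> \<open>The coefficients are peeled off one variable at a time, x, then y, then
      z.\<close>
    then have 0: "(\<Sum>i<m. (\<Sum>j<m. (\<Sum>k<m. (c (i, j, k) - d (i, j, k)) * z ^ k) * y ^ j) * x ^ i) = 0" for x y z
      by (auto simp: f_def ev_def)
    have 1: "(\<Sum>j<m. (\<Sum>k<m. (c (i, j, k) - d (i, j, k)) * z ^ k) * y ^ j) = 0" if i: "i < m" for i y z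
      using power_sum_eq_0_coeffs[OF 0 assms(2) i] by simp
    have 2: "(\<Sum>k<m. (c (i, j, k) - d (i, j, k)) * z ^ k) = 0" if i: "i < m" and j: "j < m" for i j z
      using power_sum_eq_0_coeffs[OF 1[OF i] assms(2) j] by simp
    have 3: "c (i, j, k) - d (i, j, k) = 0" if i: "i < m" and j: "j < m" and k: "k < m" for i j k
      using power_sum_eq_0_coeffs[OF 2[OF i j] assms(2) k] by simp
    have "c = d"
      by (rule PiE_ext[OF cd(1,2)]) (use 3 in auto)
    with cd(3) show False by simp
  qed
  ultimately show ?thesis using ev_poly f_def by blast
qed

section \<open>Prime fields\<close>

text \<open>Interpolation yields degree 3 (m - 1), so the requirement 6 n < q reads 18 (m - 1) < q.
  The 4 is the weight 2 of \<open>richness\<close> times its bound 2 |P|.\<close>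

lemma point_set_bound:
  fixes L :: "'a::{field,finite} pt set set" and K :: real
  assumes char: "CHAR('a) = CARD('a)" and K: "0 \<le> K" and L: "L \<subseteq> lines" "\<And>l. l \<in> L \<Longrightarrow> l \<subseteq> P"
    and planes: "\<And>p v w. indep v w \<Longrightarrow> card {l \<in> L. l \<subseteq> plane p v w} \<le> K"
    and m: "card P < m ^ 3" "18 * (m - 1) < CARD('a)"
  shows "real (card L) * CARD('a) \<le> 4 * card P + 3 * K * CARD('a) * (m - 1 :: nat)"
proof -
  have "m \<le> CARD('a)" using m(2) by linarith
  then obtain f y where f: "poly3 (3 * (m - 1)) f" "f y \<noteq> 0" "\<forall>x\<in>P. f x = 0"
    using exists_poly3_vanishing[OF m(1)] by blast
  have "real (card L) * CARD('a) \<le> 2 * richness L + K * CARD('a) * (3 * (m - 1) :: nat)"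
    by (rule lines_in_zero_set_bound[OF char K L(1) f(1) _ f(2)]) (use m(2) f(3) L(2) planes in auto)
  moreover have "richness L \<le> 2 * card P" by (rule richness_le) (rule L(2))
  ultimately show ?thesis by simp
qed

section \<open>Transfer from residue rings of integers to a field type\<close>

definition res :: "int \<Rightarrow> 'b::prime_card mod_ring" where "res = of_int"

fun res3 :: "int triple \<Rightarrow> 'b::prime_card mod_ring pt" where
  "res3 (x, y, z) = (res x, res y, res z)"

lemma res_mod: "(res (x mod int CARD('b)) :: 'b::prime_card mod_ring) = res x"
  using of_int_mod_CHAR[of x, where ?'a = "'b mod_ring"] by (simp add: res_def)

lemma inj_on_res: "inj_on (res :: int \<Rightarrow> 'b::prime_card mod_ring) (carrier (residue_ring (int CARD('b))))"
proof (rule inj_onI)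
  fix x y assume xy: "x \<in> carrier (residue_ring (int CARD('b)))" "y \<in> carrier (residue_ring (int CARD('b)))"
    and eq: "(res x :: 'b mod_ring) = res y"
  from eq have "to_int_mod_ring (of_int_mod_ring x :: 'b mod_ring) = to_int_mod_ring (of_int_mod_ring y :: 'b mod_ring)"
    by (simp add: res_def of_int_of_int_mod_ring)
  with xy show "x = y" by (simp add: residue_ring_def)
qed

lemma res_image: "(res :: int \<Rightarrow> 'b::prime_card mod_ring) ` carrier (residue_ring (int CARD('b))) = UNIV"
proof -
  have "y \<in> res ` carrier (residue_ring (int CARD('b)))" for y :: "'b mod_ring"
  proof (rule image_eqI)
    show "y = res (to_int_mod_ring y)" by (simp add: res_def of_int_of_int_mod_ring)
    show "to_int_mod_ring y \<in> carrier (residue_ring (int CARD('b)))"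
      using range_to_int_mod_ring[where ?'a = 'b] by (auto simp: residue_ring_def)
  qed
  then show ?thesis by blast
qed

lemma inj_on_res3: "inj_on (res3 :: _ \<Rightarrow> 'b::prime_card mod_ring pt) (space3 (residue_ring (int CARD('b))))"
  using inj_on_res[where ?'b = 'b] by (auto simp: inj_on_def space3_def)

lemma res3_surj:
  obtains p where "p \<in> space3 (residue_ring (int CARD('b)))" "(res3 p :: 'b::prime_card mod_ring pt) = y"
proof -
  obtain a b c where y: "y = (a, b, c)" by (cases y)
  have surj: "\<exists>u. u \<in> carrier (residue_ring (int CARD('b))) \<and> res u = t" for t :: "'b mod_ring"
    using res_image[where ?'b = 'b] by (metis UNIV_I imageE)
  obtain x1 where "x1 \<in> carrier (residue_ring (int CARD('b)))" "res x1 = a" using surj by blast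
  moreover obtain x2 where "x2 \<in> carrier (residue_ring (int CARD('b)))" "res x2 = b" using surj by blast
  moreover obtain x3 where "x3 \<in> carrier (residue_ring (int CARD('b)))" "res x3 = c" using surj by blast
  ultimately show ?thesis using that[of "(x1, x2, x3)"] by (simp add: space3_def y)
qed

text \<open>The one compatibility from which the images of lines and planes follow.\<close>

lemma res3_combination:
  "(res3 (add3 (residue_ring (int CARD('b))) x (smult3 (residue_ring (int CARD('b))) t v)) :: 'b::prime_card mod_ring pt)
     = pt_at (res3 x) (res3 v) (res t)"
proof -
  have "res ((a + b) mod int CARD('b)) = (res a + res b :: 'b mod_ring)"
     "res ((a * b) mod int CARD('b)) = (res a * res b :: 'b mod_ring)" for a b
    unfolding res_mod by (simp_all add: res_def)
  then show ?thesis by (cases x; cases v) (simp add: residue_ring_def)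
qed

lemma res3_line:
  "(res3 :: _ \<Rightarrow> 'b::prime_card mod_ring pt) ` line_through (residue_ring (int CARD('b))) x v = line (res3 x) (res3 v)"
proof -
  let ?F = "residue_ring (int CARD('b))"
  have "line_through ?F x v = (\<lambda>t. add3 ?F x (smult3 ?F t v)) ` carrier ?F"
    unfolding line_through_def by blast
  then have "(res3 :: _ \<Rightarrow> 'b mod_ring pt) ` line_through ?F x v = pt_at (res3 x) (res3 v) ` res ` carrier ?F"
    by (simp only: image_image res3_combination)
  then show ?thesis by (simp only: res_image line_def)
qed

lemma res3_plane:
  "(res3 :: _ \<Rightarrow> 'b::prime_card mod_ring pt) ` plane_through (residue_ring (int CARD('b))) x v w
     = plane (res3 x) (res3 v) (res3 w)"
proof (intro subset_antisym subsetI)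
  let ?F = "residue_ring (int CARD('b))"
  fix y :: "'b mod_ring pt"
  assume "y \<in> res3 ` plane_through ?F x v w"
  then obtain s t where "y = res3 (add3 ?F (add3 ?F x (smult3 ?F s v)) (smult3 ?F t w))"
    unfolding plane_through_def by blast
  then have "y = pt_at (pt_at (res3 x) (res3 v) (res s)) (res3 w) (res t)" by (simp only: res3_combination)
  then show "y \<in> plane (res3 x) (res3 v) (res3 w)" unfolding plane_def by blast
next
  let ?F = "residue_ring (int CARD('b))"
  fix y :: "'b mod_ring pt"
  assume "y \<in> plane (res3 x) (res3 v) (res3 w)"
  then obtain s t where y: "y = pt_at (pt_at (res3 x) (res3 v) s) (res3 w) t" unfolding plane_def by blast
  obtain s' where s: "s' \<in> carrier ?F" "res s' = s" using res_image[where ?'b = 'b] by (metis UNIV_I imageE)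
  obtain t' where t: "t' \<in> carrier ?F" "res t' = t" using res_image[where ?'b = 'b] by (metis UNIV_I imageE)
  have "y = res3 (add3 ?F (add3 ?F x (smult3 ?F s' v)) (smult3 ?F t' w))"
    unfolding y by (simp only: res3_combination s t)
  then show "y \<in> res3 ` plane_through ?F x v w" unfolding plane_through_def using s t by blast
qed

lemma res3_zero: "(res3 (zero3 (residue_ring (int CARD('b)))) :: 'b::prime_card mod_ring pt) = (0, 0, 0)"
  by (simp add: zero3_def residue_ring_def res_def)

lemma zero3_in_space3: "zero3 (residue_ring (int CARD('b::prime_card))) \<in> space3 (residue_ring (int CARD('b)))"
  using nontriv[where ?'a = 'b] by (simp add: zero3_def space3_def residue_ring_def)

lemma combination_in_space3:
  "add3 (residue_ring (int CARD('b::prime_card))) x (smult3 (residue_ring (int CARD('b))) t v)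
     \<in> space3 (residue_ring (int CARD('b)))"
  using nontriv[where ?'a = 'b] by (cases x; cases v) (simp add: space3_def residue_ring_def)

lemma res3_lines3:
  assumes "l \<in> lines3 (residue_ring (int CARD('b)))"
  shows "(res3 :: _ \<Rightarrow> 'b::prime_card mod_ring pt) ` l \<in> lines"
proof -
  obtain x v where v: "v \<in> space3 (residue_ring (int CARD('b)))" "v \<noteq> zero3 (residue_ring (int CARD('b)))"
    and l: "l = line_through (residue_ring (int CARD('b))) x v"
    using assms unfolding lines3_def by blast
  have "(res3 v :: 'b mod_ring pt) \<noteq> (0, 0, 0)"
    using inj_onD[OF inj_on_res3 _ v(1) zero3_in_space3] v(2) unfolding res3_zero by metis
  then show ?thesis unfolding l res3_line lines_def by blast
qed

text \<open>A linear relation between residues maps to one in the field. This lets planes of the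
  field be pulled back to \<open>planes3\<close>, where the Wolff bound is available.\<close>

lemma indep_res3:
  assumes "indep (res3 v) (res3 w :: 'b::prime_card mod_ring pt)"
  shows "lin_indep3 (residue_ring (int CARD('b))) v w"
  unfolding lin_indep3_def
proof (intro ballI impI)
  let ?F = "residue_ring (int CARD('b))"
  fix a b assume ab: "a \<in> carrier ?F" "b \<in> carrier ?F" and 0: "add3 ?F (smult3 ?F a v) (smult3 ?F b w) = zero3 ?F"
  have "(res3 (smult3 ?F a v) :: 'b mod_ring pt) = pt_at (0, 0, 0) (res3 v) (res a)"
    by (cases v) (simp add: residue_ring_def res_mod, simp add: res_def)
  then have "pt_at (pt_at (0, 0, 0) (res3 v) (res a)) (res3 w) (res b :: 'b mod_ring) = (0, 0, 0)"
    using res3_combination[of "smult3 ?F a v" b w, where ?'b = 'b] 0 res3_zero[where ?'b = 'b] by metis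
  then have "(res a :: 'b mod_ring) = res 0" "(res b :: 'b mod_ring) = res 0"
    using assms unfolding indep_def by (auto simp: res_def)
  moreover have "0 \<in> carrier ?F" using nontriv[where ?'a = 'b] by (simp add: residue_ring_def)
  ultimately have "a = 0 \<and> b = 0" using ab inj_onD[OF inj_on_res[where ?'b = 'b]] by blast
  then show "a = \<zero>\<^bsub>?F\<^esub> \<and> b = \<zero>\<^bsub>?F\<^esub>" by (simp add: residue_ring_def)
qed

text \<open>The whole estimate as a property of \<open>q\<close> alone, all constants being
  quantified inside, so that a prime violating it can be selected. \<open>\<kappa>\<close> at most
  1/24 keeps the interpolation degree small, since 18/24 < 1; the condition involving
  \<open>c1\<close> makes the final estimate contradictory.\<close>

definition cubic_bound :: "nat \<Rightarrow> bool" where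
  "cubic_bound q \<longleftrightarrow> (\<forall>\<kappa> C0 c1 L P. 0 < \<kappa> \<longrightarrow> \<kappa> \<le> 1 / 24 \<longrightarrow> 0 < C0 \<longrightarrow> (4 + 3 * C0) * \<kappa> \<le> c1 \<longrightarrow>
     L \<subseteq> lines3 (residue_ring (int q)) \<longrightarrow> c1 * real q ^ 2 \<le> real (card L) \<longrightarrow>
     wolff_axiom (residue_ring (int q)) C0 L \<longrightarrow> P \<subseteq> space3 (residue_ring (int q)) \<longrightarrow> (\<forall>l\<in>L. l \<subseteq> P) \<longrightarrow>
     (\<kappa> * real q) ^ 3 \<le> real (card P))"

lemma cubic_bound_CARD: "cubic_bound CARD('b::prime_card)"
  unfolding cubic_bound_def
proof (intro allI impI)
  define F where "F = residue_ring (int CARD('b))"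
  define q where "q = real CARD('b)"
  fix \<kappa> C0 c1 :: real and L P
  assume \<kappa>: "0 < \<kappa>" "\<kappa> \<le> 1 / 24" and C0: "0 < C0" and c1: "(4 + 3 * C0) * \<kappa> \<le> c1"
    and "L \<subseteq> lines3 (residue_ring (int CARD('b)))" "c1 * real CARD('b) ^ 2 \<le> real (card L)"
    "wolff_axiom (residue_ring (int CARD('b))) C0 L" "P \<subseteq> space3 (residue_ring (int CARD('b)))"
    and LP: "\<forall>l\<in>L. l \<subseteq> P"
  then have L: "L \<subseteq> lines3 F" and card: "c1 * q ^ 2 \<le> real (card L)" and W: "wolff_axiom F C0 L" 
    and P: "P \<subseteq> space3 F" by (simp_all add: F_def q_def)
  have cF: "real (card (carrier F)) = q" by (simp add: F_def q_def residue_ring_def)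
  have finP: "finite P" by (rule finite_subset[OF P]) (simp add: F_def space3_def residue_ring_def)
  have finL: "finite L" by (rule finite_subset[of _ "Pow P"]) (use LP finP in auto)
  define \<rho> where "\<rho> = (res3 :: _ \<Rightarrow> 'b mod_ring pt)"
  have inj: "inj_on \<rho> (space3 F)" unfolding \<rho>_def F_def by (rule inj_on_res3)
  have q1: "1 < q" using nontriv[where ?'a = 'b] by (simp add: q_def)
  show "(\<kappa> * real CARD('b)) ^ 3 \<le> real (card P)"
  proof (rule ccontr)
    assume "\<not> ?thesis"
    then have small: "real (card P) < (\<kappa> * q) ^ 3" by (simp add: q_def)
    \<comment> \<open>The least natural number above \<open>\<kappa> * q\<close>: large enough for
      interpolation, while \<open>m - 1\<close> is at most \<open>\<kappa> * q\<close>.\<close>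
    define m where "m = nat \<lfloor>\<kappa> * q\<rfloor> + 1"
    have kq: "0 \<le> \<kappa> * q" using \<kappa> q1 by simp
    have m1: "real (m - 1) \<le> \<kappa> * q" using kq by (simp add: m_def)
    have m2: "\<kappa> * q < real m" using kq by (simp add: m_def) linarith
    have "(\<kappa> * q) ^ 3 < real m ^ 3" using m2 kq by (intro power_strict_mono) auto
    then have cm: "card P < m ^ 3" using small by (metis less_trans of_nat_less_iff of_nat_power)
    have "18 * (\<kappa> * q) \<le> 18 * (1 / 24 * q)" using \<kappa> q1 by (intro mult_left_mono mult_right_mono) auto
    then have "18 * real (m - 1) < q" using m1 q1 by linarith
    then have "real (18 * (m - 1)) < real CARD('b)" by (simp add: q_def)
    then have md: "18 * (m - 1) < CARD('b)" by (simp only: of_nat_less_iff)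
    have bound: "real (card ((`) \<rho> ` L)) * CARD('b mod_ring) \<le> 4 * card (\<rho> ` P) + 3 * (C0 * q) * CARD('b mod_ring) * (m - 1 :: nat)"
    proof (rule point_set_bound)
      show "CHAR('b mod_ring) = CARD('b mod_ring)" by simp
      show "0 \<le> C0 * q" using C0 q1 by simp
      show "(`) \<rho> ` L \<subseteq> lines" using res3_lines3 L unfolding \<rho>_def F_def by blast
      show "l \<subseteq> \<rho> ` P" if "l \<in> (`) \<rho> ` L" for l using that LP by blast
      have "card (\<rho> ` P) \<le> card P" by (rule card_image_le[OF finP])
      then show "card (\<rho> ` P) < m ^ 3" using cm by linarith
      show "18 * (m - 1) < CARD('b mod_ring)" using md by simp
      fix p v w :: "'b mod_ring pt" assume ind: "indep v w"
      obtain p' where p: "p' \<in> space3 F" "\<rho> p' = p" unfolding F_def \<rho>_def by (rule res3_surj)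
      obtain v' where v: "v' \<in> space3 F" "\<rho> v' = v" unfolding F_def \<rho>_def by (rule res3_surj)
      obtain w' where w: "w' \<in> space3 F" "\<rho> w' = w" unfolding F_def \<rho>_def by (rule res3_surj)
      have "lin_indep3 F v' w'" using indep_res3 ind v(2) w(2) unfolding F_def \<rho>_def by blast
      then have "plane_through F p' v' w' \<in> planes3 F" unfolding planes3_def using p(1) v(1) w(1) by blast
      then have *: "real (card {l \<in> L. l \<subseteq> plane_through F p' v' w'}) \<le> C0 * q"
        using W unfolding wolff_axiom_def cF by blast
      have pl: "plane p v w = \<rho> ` plane_through F p' v' w'"
        using p(2) v(2) w(2) unfolding \<rho>_def F_def res3_plane by simp
      have pl_sub: "plane_through F p' v' w' \<subseteq> space3 F"
        unfolding plane_through_def F_def using combination_in_space3 by blast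
      \<comment> \<open>Inclusion of a line in a plane is reflected by \<open>\<rho>\<close>,
        because both lie in \<open>space3 F\<close>, where it is injective.\<close>
      have "{l \<in> (`) \<rho> ` L. l \<subseteq> plane p v w} \<subseteq> (`) \<rho> ` {l \<in> L. l \<subseteq> plane_through F p' v' w'}"
      proof
        fix l assume "l \<in> {l \<in> (`) \<rho> ` L. l \<subseteq> plane p v w}"
        then obtain l' where l': "l' \<in> L" "l = \<rho> ` l'" "\<rho> ` l' \<subseteq> \<rho> ` plane_through F p' v' w'"
          unfolding pl by blast
        have "l' \<subseteq> space3 F" using l'(1) LP P by blast
        then have "l' \<subseteq> plane_through F p' v' w'"
          using l'(3) pl_sub inj unfolding inj_on_def by blast
        then show "l \<in> (`) \<rho> ` {l \<in> L. l \<subseteq> plane_through F p' v' w'}" using l'(1,2) by blast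
      qed
      then have "card {l \<in> (`) \<rho> ` L. l \<subseteq> plane p v w} \<le> card {l \<in> L. l \<subseteq> plane_through F p' v' w'}"
        using finL by (intro surj_card_le) auto
      then show "real (card {l \<in> (`) \<rho> ` L. l \<subseteq> plane p v w}) \<le> C0 * q" using * by linarith
    qed
    have "inj_on ((`) \<rho>) L"
      by (rule inj_on_subset[OF inj_on_image_Pow[OF inj]]) (use LP P in auto)
    then have cL: "card ((`) \<rho> ` L) = card L" by (rule card_image)
    have "c1 * q ^ 2 * q \<le> real (card L) * q" using card q1 by (intro mult_right_mono) auto
    also have "\<dots> \<le> 4 * real (card P) + 3 * (C0 * q) * q * real (m - 1)"
      using bound card_image_le[OF finP, of \<rho>] by (simp add: cL q_def)
    also have "\<dots> < 4 * (\<kappa> * q) ^ 3 + 3 * (C0 * q) * q * (\<kappa> * q)"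
      using small m1 C0 q1 by (intro add_less_le_mono mult_left_mono) auto
    also have "\<dots> \<le> 4 * (\<kappa> * q ^ 3) + 3 * (C0 * q) * q * (\<kappa> * q)"
    proof -
      \<comment> \<open>Since \<open>\<kappa>\<close> is below 1, both error terms become linear in
        it, matching the hypothesis on \<open>c1\<close>.\<close>
      have "\<kappa> ^ 3 \<le> \<kappa> ^ 1" using \<kappa> by (intro power_decreasing) auto
      then show ?thesis using q1 by (simp add: power_mult_distrib)
    qed
    also have "\<dots> = (4 + 3 * C0) * \<kappa> * q ^ 3" by (simp add: algebra_simps power3_eq_cube)
    also have "\<dots> \<le> c1 * q ^ 3" using c1 q1 by (intro mult_right_mono) auto
    finally show False by (simp add: power3_eq_cube power2_eq_square)
  qed
qed

text \<open>A type whose cardinality is a prime violating the bound, if there is one; it lets the result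
  for fields given as types be applied to a prime that is a variable of the formula.\<close>

typedef critical_index = "{..<(SOME q::nat. prime q \<and> ((\<forall>r. prime r \<longrightarrow> cubic_bound r) \<or> \<not> cubic_bound q))}"
proof -
  have "prime (SOME q::nat. prime q \<and> ((\<forall>r. prime r \<longrightarrow> cubic_bound r) \<or> \<not> cubic_bound q))"
    by (rule someI2_ex) (use two_is_prime_nat in blast)+
  then show ?thesis by (auto dest: prime_gt_0_nat)
qed

text \<open>The disjunction always has a witness: a counterexample if there is one, otherwise any
  prime.\<close>

lemma CARD_critical_index:
  "prime CARD(critical_index) \<and> ((\<forall>r. prime r \<longrightarrow> cubic_bound r) \<or> \<not> cubic_bound CARD(critical_index))"
proof -
  have card: "CARD(critical_index) = (SOME q::nat. prime q \<and> ((\<forall>r. prime r \<longrightarrow> cubic_bound r) \<or> \<not> cubic_bound q))"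
    using type_definition.card[OF type_definition_critical_index] by simp
  have "\<exists>q::nat. prime q \<and> ((\<forall>r. prime r \<longrightarrow> cubic_bound r) \<or> \<not> cubic_bound q)"
    using two_is_prime_nat by blast
  then show ?thesis unfolding card by (rule someI_ex)
qed

instance critical_index :: prime_card
  by standard (use CARD_critical_index in blast)

text \<open>The bound holds for the cardinality of \<open>critical_index\<close>, so that prime is
  no counterexample, and hence no prime is.\<close>

lemma cubic_bound_prime: "prime q \<Longrightarrow> cubic_bound q"
  using CARD_critical_index cubic_bound_CARD[where ?'b = critical_index] by blast

theorem theorem8p1:
  "\<exists>\<epsilon>::real. \<epsilon> > 0 \<and>
    (\<forall>C0 c1 C1 :: real. C0 > 0 \<longrightarrow> c1 > 0 \<longrightarrow> C1 > 0 \<longrightarrow>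
      (\<exists>c::real. c > 0 \<and>
        (\<forall>q::nat. prime q \<longrightarrow>
          (let F = residue_ring (int q); N = real (card (carrier F)) in
            \<forall>L P. L \<subseteq> lines3 F \<longrightarrow>
              c1 * N ^ 2 \<le> real (card L) \<longrightarrow> real (card L) \<le> C1 * N ^ 2 \<longrightarrow>
              wolff_axiom F C0 L \<longrightarrow>
              P \<subseteq> space3 F \<longrightarrow> (\<forall>l\<in>L. l \<subseteq> P) \<longrightarrow>
              real (card P) \<ge> c * N powr (5 / 2 + \<epsilon>)))))"
proof (rule exI[of _ "1 / 2"], intro conjI allI impI)
  show "(0 :: real) < 1 / 2" by simp
  fix C0 c1 C1 :: real
  assume C: "0 < C0" "0 < c1" "0 < C1"
  \<comment> \<open>The largest value allowed by the two upper bounds in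
    \<open>cubic_bound\<close>.\<close>
  define \<kappa> where "\<kappa> = min (1 / 24) (c1 / (4 + 3 * C0))"
  have \<kappa>: "0 < \<kappa>" "\<kappa> \<le> 1 / 24" unfolding \<kappa>_def by (use C in simp, rule min.cobounded1)
  have "\<kappa> \<le> c1 / (4 + 3 * C0)" by (simp add: \<kappa>_def)
  then have "(4 + 3 * C0) * \<kappa> \<le> c1" using C by (simp add: field_simps)
  note bound = cubic_bound_prime[unfolded cubic_bound_def, rule_format, OF _ \<kappa> C(1) this]
  show "\<exists>c::real. c > 0 \<and>
        (\<forall>q::nat. prime q \<longrightarrow>
          (let F = residue_ring (int q); N = real (card (carrier F)) in
            \<forall>L P. L \<subseteq> lines3 F \<longrightarrow>
              c1 * N ^ 2 \<le> real (card L) \<longrightarrow> real (card L) \<le> C1 * N ^ 2 \<longrightarrow>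
              wolff_axiom F C0 L \<longrightarrow>
              P \<subseteq> space3 F \<longrightarrow> (\<forall>l\<in>L. l \<subseteq> P) \<longrightarrow>
              real (card P) \<ge> c * N powr (5 / 2 + 1 / 2)))"
  proof (rule exI[of _ "\<kappa> ^ 3"], unfold Let_def, intro conjI allI impI)
    show "0 < \<kappa> ^ 3" using \<kappa> by simp
    fix q :: nat and L P
    let ?F = "residue_ring (int q)"
    assume q: "prime q" and L: "L \<subseteq> lines3 ?F" "c1 * real (card (carrier ?F)) ^ 2 \<le> real (card L)"
      "wolff_axiom ?F C0 L" "P \<subseteq> space3 ?F" "\<forall>l\<in>L. l \<subseteq> P"
    have N: "real (card (carrier ?F)) = real q" by (simp add: residue_ring_def)
    have "(\<kappa> * real q) ^ 3 \<le> real (card P)"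
      by (rule bound[OF q L(1) _ L(3,4)]) (use L(2,5) in \<open>auto simp: N\<close>)
    moreover have "real q powr (5 / 2 + 1 / 2) = real q ^ 3"
      using prime_gt_0_nat[OF q] by (simp add: powr_numeral)
    ultimately show "\<kappa> ^ 3 * real (card (carrier ?F)) powr (5 / 2 + 1 / 2) \<le> real (card P)"
      unfolding N by (simp add: power_mult_distrib)
  qed
qed

end
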